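(* Let $(\mathcal{E},\Phi)$ be a stationary axisymmetric electrovac solution, i.e. complex-valued functions $\mathcal{E}(z,\rho)$ and $\Phi(z,\rho)$ satisfying the Ernst equations $$(\mathrm{Re}\,\mathcal{E}+|\Phi|^2)\nabla^2\mathcal{E}=(\boldsymbol{\nabla}\mathcal{E}+2\Phi^*\boldsymbol{\nabla}\Phi)\cdot\boldsymbol{\nabla}\mathcal{E},$$ $$(\mathrm{Re}\,\mathcal{E}+|\Phi|^2)\nabla^2\Phi=(\boldsymbol{\nabla}\mathcal{E}+2\Phi^*\boldsymbol{\nabla}\Phi)\cdot\boldsymbol{\nabla}\Phi,$$ and consider the associated spacetime with metric fields $f,\omega,\gamma$. Then: (1) The solution is equatorially symmetric if and only if, for a suitable choice of the origin of the $z$-coordinate, there is a real constant $\delta$ such that $$\mathcal{E}(-z,\rho)=\mathcal{E}(z,\rho)^*,\qquad \Phi(-z,\rho)=e^{2i\delta}\,\Phi(z,\rho)^*.$$ (2) The solution is equatorially antisymmetric if and only if, for a suitable choice of the origin of the $z$-coordinate, $$\mathcal{E}(-z,\rho)=\mathcal{E}(z,\rho),\qquad \Phi(-z,\rho)=\pm\Phi(z,\rho)$$ for one of the two choices of sign (the same for all $(z,\rho)$).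
   Context: Coordinates $(z,\rho,\varphi)$ are cylindrical coordinates on three-dimensional flat Euclidean space; all functions are independent of $\varphi$. The symbol $\nabla^2$ is the flat Laplacian, $\nabla^2A=A_{,zz}+A_{,\rho\rho}+\rho^{-1}A_{,\rho}$, and $\boldsymbol{\nabla}A\cdot\boldsymbol{\nabla}B=A_{,z}B_{,z}+A_{,\rho}B_{,\rho}$. A star denotes complex conjugation, and a comma denotes partial differentiation. Associated metric. The spacetime has line element $$ds^2=f^{-1}\left[e^{2\gamma}(dz^2+d\rho^2)+\rho^2d\varphi^2\right]-f\,[dt-\omega\,d\varphi]^2,$$ where the real functions $f,\omega,\gamma$ of $(z,\rho)$ are obtained from the Ernst potentials $\mathcal{E},\Phi$ by $$f=\mathrm{Re}\,\mathcal{E}+|\Phi|^2,\qquad \chi=\mathrm{Im}\,\mathcal{E},$$ $$\omega_{,z}=-\rho f^{-2}[\chi_{,\rho}+2\,\mathrm{Im}(\Phi^*\Phi_{,\rho})],\qquad \omega_{,\rho}=\rho f^{-2}[\chi_{,z}+2\,\mathrm{Im}(\Phi^*\Phi_{,z})],$$ $$\gamma_{,z}=\tfrac14\rho f^{-2}\big[(\mathcal{E}_{,\rho}+2\Phi^*\Phi_{,\rho})(\mathcal{E}^*_{,z}+2\Phi\Phi^*_{,z})+(\mathcal{E}_{,z}+2\Phi^*\Phi_{,z})(\mathcal{E}^*_{,\rho}+2\Phi\Phi^*_{,\rho})\big]-\rho f^{-1}(\Phi_{,\rho}\Phi^*_{,z}+\Phi_{,z}\Phi^*_{,\rho}),$$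 $$\gamma_{,\rho}=\tfrac14\rho f^{-2}\big[(\mathcal{E}_{,\rho}+2\Phi^*\Phi_{,\rho})(\mathcal{E}^*_{,\rho}+2\Phi\Phi^*_{,\rho})-(\mathcal{E}_{,z}+2\Phi^*\Phi_{,z})(\mathcal{E}^*_{,z}+2\Phi\Phi^*_{,z})\big]-\rho f^{-1}(\Phi_{,\rho}\Phi^*_{,\rho}-\Phi_{,z}\Phi^*_{,z}).$$ The integrability of these equations is guaranteed by the Ernst equations; $\omega$ and $\gamma$ are determined up to additive integration constants, which may be chosen appropriately. Definition. The spacetime is "equatorially symmetric" when there exists a choice of the origin of $z$ such that, under $z\to-z$, $\rho\to\rho$, the fields $f,\omega,\gamma$ are all even functions of $z$. It is "equatorially antisymmetric" when there exist a choice of the origin of $z$ and a constant $\omega_0$ such that $f$ and $\gamma$ are even functions of $z$ while $\omega-\omega_0$ is an odd function of $z$.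
   Formalization: Proved on connected regions with ρ>0, f≠0. As stated, "only if" fails (E=1+i, Φ=0): the laws are shown for E−2a*Φ−|a|²+ib, Φ+a with suitable constants a complex, b real, and literally for E, Φ when Im E→0 and Φ→0 at infinity. *)

theory Defs
  imports "HOL-Analysis.Analysis"
begin

text \<open>Functions of the cylindrical coordinates are functions of the pair \<open>(z, \<rho>)\<close>, studied on an
  open connected region of the half plane \<open>\<rho> > 0\<close>.\<close>

definition pd_z :: "(real \<times> real \<Rightarrow> 'a::real_normed_vector) \<Rightarrow> real \<times> real \<Rightarrow> 'a" where
  "pd_z A p = frechet_derivative A (at p) (1, 0)"

definition pd_rho :: "(real \<times> real \<Rightarrow> 'a::real_normed_vector) \<Rightarrow> real \<times> real \<Rightarrow> 'a" where
  "pd_rho A p = frechet_derivative A (at p) (0, 1)"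

definition C1_on :: "(real \<times> real) set \<Rightarrow> (real \<times> real \<Rightarrow> 'a::real_normed_vector) \<Rightarrow> bool" where
  "C1_on D A \<longleftrightarrow> A differentiable_on D \<and> continuous_on D (pd_z A) \<and> continuous_on D (pd_rho A)"

definition C2_on :: "(real \<times> real) set \<Rightarrow> (real \<times> real \<Rightarrow> 'a::real_normed_vector) \<Rightarrow> bool" where
  "C2_on D A \<longleftrightarrow> C1_on D A \<and> C1_on D (pd_z A) \<and> C1_on D (pd_rho A)"

definition flat_laplacian :: "(real \<times> real \<Rightarrow> complex) \<Rightarrow> real \<times> real \<Rightarrow> complex" where
  "flat_laplacian A p =
     pd_z (pd_z A) p + pd_rho (pd_rho A) p + pd_rho A p / of_real (snd p)"

definition ernst_f ::
    "(real \<times> real \<Rightarrow> complex) \<Rightarrow> (real \<times> real \<Rightarrow> complex) \<Rightarrow> real \<times> real \<Rightarrow> real" where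
  "ernst_f E \<Phi> p = Re (E p) + (cmod (\<Phi> p))\<^sup>2"

text \<open>The components of the complex vector field \<open>\<nabla>E + 2 \<Phi>\<^sup>* \<nabla>\<Phi>\<close>.\<close>

definition ernst_G_z ::
    "(real \<times> real \<Rightarrow> complex) \<Rightarrow> (real \<times> real \<Rightarrow> complex) \<Rightarrow> real \<times> real \<Rightarrow> complex" where
  "ernst_G_z E \<Phi> p = pd_z E p + 2 * cnj (\<Phi> p) * pd_z \<Phi> p"

definition ernst_G_rho ::
    "(real \<times> real \<Rightarrow> complex) \<Rightarrow> (real \<times> real \<Rightarrow> complex) \<Rightarrow> real \<times> real \<Rightarrow> complex" where
  "ernst_G_rho E \<Phi> p = pd_rho E p + 2 * cnj (\<Phi> p) * pd_rho \<Phi> p"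

text \<open>The condition \<open>f \<noteq> 0\<close> is what makes the equations for \<open>\<omega>\<close> and \<open>\<gamma>\<close> below, which contain
  \<open>f\<^sup>-\<^sup>1\<close> and \<open>f\<^sup>-\<^sup>2\<close>, meaningful; no sign of \<open>f\<close> is prescribed.\<close>

definition ernst_solution ::
    "(real \<times> real) set \<Rightarrow> (real \<times> real \<Rightarrow> complex) \<Rightarrow> (real \<times> real \<Rightarrow> complex) \<Rightarrow> bool" where
  "ernst_solution D E \<Phi> \<longleftrightarrow>
     C2_on D E \<and> C2_on D \<Phi> \<and>
     (\<forall>p\<in>D. ernst_f E \<Phi> p \<noteq> 0 \<and>
        of_real (ernst_f E \<Phi> p) * flat_laplacian E p =
          ernst_G_z E \<Phi> p * pd_z E p + ernst_G_rho E \<Phi> p * pd_rho E p \<and>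
        of_real (ernst_f E \<Phi> p) * flat_laplacian \<Phi> p =
          ernst_G_z E \<Phi> p * pd_z \<Phi> p + ernst_G_rho E \<Phi> p * pd_rho \<Phi> p)"

text \<open>\<open>metric_fields D E \<Phi> f \<omega> \<gamma>\<close>: the fields of the line element
  \<open>f\<^sup>-\<^sup>1 [exp (2 \<gamma>) (dz\<^sup>2 + d\<rho>\<^sup>2) + \<rho>\<^sup>2 d\<phi>\<^sup>2] - f (dt - \<omega> d\<phi>)\<^sup>2\<close> belonging to the Ernst
  potentials. The right-hand sides of the equations for \<open>\<gamma>\<close> are complex terms with real values.
  The additive constants in \<open>\<omega>\<close> and \<open>\<gamma>\<close> are left free.\<close>

definition metric_fields ::
    "(real \<times> real) set \<Rightarrow> (real \<times> real \<Rightarrow> complex) \<Rightarrow> (real \<times> real \<Rightarrow> complex) \<Rightarrow>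
     (real \<times> real \<Rightarrow> real) \<Rightarrow> (real \<times> real \<Rightarrow> real) \<Rightarrow> (real \<times> real \<Rightarrow> real) \<Rightarrow> bool" where
  "metric_fields D E \<Phi> f \<omega> \<gamma> \<longleftrightarrow>
     \<omega> differentiable_on D \<and> \<gamma> differentiable_on D \<and>
     (\<forall>p\<in>D. 
        f p = ernst_f E \<Phi> p \<and>
        pd_z \<omega> p = - (snd p / (f p)\<^sup>2) *
          (pd_rho (\<lambda>q. Im (E q)) p + 2 * Im (cnj (\<Phi> p) * pd_rho \<Phi> p)) \<and>
        pd_rho \<omega> p = (snd p / (f p)\<^sup>2) *
          (pd_z (\<lambda>q. Im (E q)) p + 2 * Im (cnj (\<Phi> p) * pd_z \<Phi> p)) \<and>
        of_real (pd_z \<gamma> p) =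
          of_real (snd p / (4 * (f p)\<^sup>2)) *
            (ernst_G_rho E \<Phi> p * cnj (ernst_G_z E \<Phi> p)
             + ernst_G_z E \<Phi> p * cnj (ernst_G_rho E \<Phi> p))
          - of_real (snd p / f p) *
            (pd_rho \<Phi> p * cnj (pd_z \<Phi> p) + pd_z \<Phi> p * cnj (pd_rho \<Phi> p)) \<and>
        of_real (pd_rho \<gamma> p) =
          of_real (snd p / (4 * (f p)\<^sup>2)) *
            (ernst_G_rho E \<Phi> p * cnj (ernst_G_rho E \<Phi> p)
             - ernst_G_z E \<Phi> p * cnj (ernst_G_z E \<Phi> p))
          - of_real (snd p / f p) *
            (pd_rho \<Phi> p * cnj (pd_rho \<Phi> p) - pd_z \<Phi> p * cnj (pd_z \<Phi> p)))"

text \<open>The map \<open>z \<mapsto> -z\<close> once the origin of \<open>z\<close> has been moved to \<open>z0\<close>: it exchanges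
  \<open>z0 + z\<close> and \<open>z0 - z\<close>.\<close>

definition reflect :: "real \<Rightarrow> real \<times> real \<Rightarrow> real \<times> real" where
  "reflect z0 p = (2 * z0 - fst p, snd p)"

definition equatorially_symmetric ::
    "(real \<times> real) set \<Rightarrow> (real \<times> real \<Rightarrow> real) \<Rightarrow> (real \<times> real \<Rightarrow> real) \<Rightarrow>
     (real \<times> real \<Rightarrow> real) \<Rightarrow> bool" where
  "equatorially_symmetric D f \<omega> \<gamma> \<longleftrightarrow>
     (\<exists>z0. \<forall>p\<in>D. reflect z0 p \<in> D \<and>
        f (reflect z0 p) = f p \<and> \<omega> (reflect z0 p) = \<omega> p \<and> \<gamma> (reflect z0 p) = \<gamma> p)"

definition equatorially_antisymmetric ::
    "(real \<times> real) set \<Rightarrow> (real \<times> real \<Rightarrow> real) \<Rightarrow> (real \<times> real \<Rightarrow> real) \<Rightarrow>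
     (real \<times> real \<Rightarrow> real) \<Rightarrow> bool" where
  "equatorially_antisymmetric D f \<omega> \<gamma> \<longleftrightarrow>
     (\<exists>z0 \<omega>0. \<forall>p\<in>D. reflect z0 p \<in> D \<and>
        f (reflect z0 p) = f p \<and> \<gamma> (reflect z0 p) = \<gamma> p \<and>
        \<omega> (reflect z0 p) - \<omega>0 = - (\<omega> p - \<omega>0))"

definition symmetric_potentials ::
    "(real \<times> real) set \<Rightarrow> (real \<times> real \<Rightarrow> complex) \<Rightarrow> (real \<times> real \<Rightarrow> complex) \<Rightarrow> bool" where
  "symmetric_potentials D E \<Phi> \<longleftrightarrow>
     (\<exists>z0. \<exists>\<delta>::real. \<forall>p\<in>D. reflect z0 p \<in> D \<and>
        E (reflect z0 p) = cnj (E p) \<and>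
        \<Phi> (reflect z0 p) = exp (2 * \<i> * of_real \<delta>) * cnj (\<Phi> p))"

definition antisymmetric_potentials ::
    "(real \<times> real) set \<Rightarrow> (real \<times> real \<Rightarrow> complex) \<Rightarrow> (real \<times> real \<Rightarrow> complex) \<Rightarrow> bool" where
  "antisymmetric_potentials D E \<Phi> \<longleftrightarrow>
     (\<exists>z0. \<exists>s\<in>{1, -1}. \<forall>p\<in>D. reflect z0 p \<in> D \<and>
        E (reflect z0 p) = E p \<and> \<Phi> (reflect z0 p) = s * \<Phi> p)"

text \<open>Ernst potentials carry additive integration constants of their own: for all constants
  \<open>a \<in> \<complex>\<close>, \<open>b \<in> \<real>\<close> the replacement
  \<open>E \<mapsto> E - 2 a\<^sup>* \<Phi> - \<bar>a\<bar>\<^sup>2 + i b\<close>, \<open>\<Phi> \<mapsto> \<Phi> + a\<close> leaves \<open>f\<close> and \<open>\<nabla>E + 2 \<Phi>\<^sup>* \<nabla>\<Phi>\<close>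
  unchanged, maps solutions of the Ernst equations to solutions, and does not change the
  spacetime. It does destroy a reflection law of the potentials: \<open>E = 1 + i\<close>, \<open>\<Phi> = 0\<close> is flat
  space, but \<open>E (-z, \<rho>) \<noteq> E (z, \<rho>)\<^sup>*\<close>.\<close>

definition gauge_E ::
    "complex \<Rightarrow> real \<Rightarrow> (real \<times> real \<Rightarrow> complex) \<Rightarrow> (real \<times> real \<Rightarrow> complex) \<Rightarrow>
     real \<times> real \<Rightarrow> complex" where
  "gauge_E a b E \<Phi> p = E p - 2 * cnj a * \<Phi> p - of_real ((cmod a)\<^sup>2) + \<i> * of_real b"

definition gauge_Phi ::
    "complex \<Rightarrow> (real \<times> real \<Rightarrow> complex) \<Rightarrow> real \<times> real \<Rightarrow> complex" where
  "gauge_Phi a \<Phi> p = \<Phi> p + a"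

text \<open>The customary choice of these constants: \<open>\<chi> \<rightarrow> 0\<close> and \<open>\<Phi> \<rightarrow> 0\<close> at infinity. It holds in
  particular when \<open>E \<rightarrow> 1\<close> and \<open>\<Phi> \<rightarrow> 0\<close>, as for asymptotically flat solutions.\<close>

definition normalized_at_infinity ::
    "(real \<times> real) set \<Rightarrow> (real \<times> real \<Rightarrow> complex) \<Rightarrow> (real \<times> real \<Rightarrow> complex) \<Rightarrow> bool" where
  "normalized_at_infinity D E \<Phi> \<longleftrightarrow>
     \<not> bounded D \<and>
     ((\<lambda>p. Im (E p)) \<longlongrightarrow> 0) (inf at_infinity (principal D)) \<and>
     (\<Phi> \<longlongrightarrow> 0) (inf at_infinity (principal D))"

end

theory Submission
  imports Defs
begin

text \<open>The vector field \<open>G = \<nabla>E + 2 \<Phi>\<^sup>* \<nabla>\<Phi>\<close> is determined by \<open>f\<close> and \<open>\<omega>\<close> alone: its real part is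
  \<open>\<nabla>f\<close>, its imaginary part is given by the equations for \<open>\<omega>\<close>. The equations for \<open>\<gamma>\<close>, together with
  the divergence and the curl of \<open>G\<close>, then determine \<open>\<bar>\<Phi>\<^sub>z\<bar>\<close>, \<open>\<bar>\<Phi>\<^sub>\<rho>\<bar>\<close> and \<open>\<Phi>\<^sub>\<rho> \<Phi>\<^sub>z\<^sup>*\<close>. So two
  solutions with the same metric satisfy \<open>\<nabla>\<Phi>' = \<kappa> \<nabla>\<Phi>\<close> with \<open>\<bar>\<kappa>\<bar> = 1\<close>, and the linear equation
  \<open>f \<nabla>\<^sup>2\<Phi> = G \<cdot> \<nabla>\<Phi>\<close>, common to both, makes \<open>\<kappa>\<close> locally constant where \<open>\<nabla>\<Phi> \<noteq> 0\<close>. On a small disc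
  \<open>\<Phi>' - \<kappa> \<Phi>\<close> is thus constant, hence on the whole region by unique continuation for that equation.

  This is applied to a solution and its mirror image \<open>\<sigma> (\<Phi> (-z, \<rho>))\<close>, where \<open>\<sigma>\<close> is complex
  conjugation in the symmetric case and the identity in the antisymmetric case. The region meets
  the mirror line, and the gauge in which \<open>\<Phi>\<close> and \<open>Im E\<close> vanish at a point of it removes the
  constants of integration.\<close>

section \<open>Partial derivatives\<close>

text \<open>The obstacle is the zero set of the gradient of \<Phi>. The phase \<kappa> exists only
  off this set, whose complement could a priori have several components carrying different phases.
  The potentials are assumed twice continuously differentiable, so a power series argument is not at
  hand. What helps is linearity: once f and G are known to be shared, the second Ernst equation has
  given coefficients, and \<Phi>' - \<kappa> \<Phi>, with \<kappa> frozen at its value on one disc,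
  solves it too. In two variables the gradient of a solution satisfies a first-order system of
  Cauchy-Riemann type with a perturbation of order zero, and the energy of such a field over growing
  circles can be controlled. The region may have holes, so nothing is integrated along paths:
  equality of two functions always comes from a vanishing gradient on a connected open set and
  agreement at one point.\<close>

abbreviation has_pd :: "(real \<times> real \<Rightarrow> 'a::real_normed_vector) \<Rightarrow> real \<times> real \<Rightarrow> 'a \<Rightarrow> 'a \<Rightarrow> bool" where
  "has_pd A p a b \<equiv> (A has_derivative (\<lambda>h. fst h *\<^sub>R a + snd h *\<^sub>R b)) (at p)"

text \<open>\<open>pd_z\<close> and \<open>pd_rho\<close> come from
  \<open>frechet_derivative\<close>, an unspecified choice where no derivative exists.
  \<open>has_pd\<close> carries differentiability together with both values, so calculations avoid
  that case.\<close>

lemma has_pd_imp: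
  assumes "has_pd A p a b"
  shows "pd_z A p = a" "pd_rho A p = b" "A differentiable (at p)"
proof -
  have "frechet_derivative A (at p) = (\<lambda>h. fst h *\<^sub>R a + snd h *\<^sub>R b)"
    by (rule frechet_derivative_at[OF assms, symmetric])
  then show "pd_z A p = a" "pd_rho A p = b" by (simp_all add: pd_z_def pd_rho_def)
  show "A differentiable (at p)" using assms by (rule differentiableI)
qed

lemma differentiable_has_pd:
  assumes "A differentiable (at p)"
  shows "has_pd A p (pd_z A p) (pd_rho A p)"
proof -
  let ?L = "frechet_derivative A (at p)"
  have L: "(A has_derivative ?L) (at p)"
    using assms frechet_derivative_works by blast
  interpret linear ?L using L has_derivative_linear by blast
  have "?L h = fst h *\<^sub>R pd_z A p + snd h *\<^sub>R pd_rho A p" for h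
  proof -
    have "?L h = ?L (fst h *\<^sub>R (1, 0) + snd h *\<^sub>R (0, 1))" by (cases h) simp
    then show ?thesis by (simp only: add scaleR pd_z_def pd_rho_def)
  qed
  then have "?L = (\<lambda>h. fst h *\<^sub>R pd_z A p + snd h *\<^sub>R pd_rho A p)" by blast
  then show ?thesis using L by simp
qed

lemma has_pd_linear:
  assumes "bounded_linear L" "has_pd A p a b"
  shows "has_pd (\<lambda>q. L (A q)) p (L a) (L b)"
proof -
  interpret bounded_linear L by fact
  show ?thesis using bounded_linear.has_derivative[OF assms] by (simp add: add scaleR)
qed

lemma has_pd_add:
  "has_pd A p a b \<Longrightarrow> has_pd B p c d \<Longrightarrow> has_pd (\<lambda>q. A q + B q) p (a + c) (b + d)"
  by (drule (1) has_derivative_add) (simp add: algebra_simps)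

lemma has_pd_diff:
  "has_pd A p a b \<Longrightarrow> has_pd B p c d \<Longrightarrow> has_pd (\<lambda>q. A q - B q) p (a - c) (b - d)"
  by (drule (1) has_derivative_diff) (simp add: algebra_simps)

lemma has_pd_mult:
  fixes A B :: "real \<times> real \<Rightarrow> complex"
  shows "has_pd A p a b \<Longrightarrow> has_pd B p c d \<Longrightarrow>
    has_pd (\<lambda>q. A q * B q) p (A p * c + a * B p) (A p * d + b * B p)"
  by (drule (1) has_derivative_mult) (simp add: algebra_simps scaleR_conv_of_real)

lemma has_pd_cong:
  assumes "has_pd A p a b" "open D" "p \<in> D" "\<And>q. q \<in> D \<Longrightarrow> A q = B q"
  shows "has_pd B p a b"
  by (rule has_derivative_transform_within_open[OF assms])

lemma has_pd_chain:
  assumes "has_pd A (g t) x y" "(g has_vector_derivative v) (at t within S)"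
  shows "((\<lambda>t. A (g t)) has_vector_derivative (fst v *\<^sub>R x + snd v *\<^sub>R y)) (at t within S)"
  using has_derivative_compose[OF assms(2)[unfolded has_vector_derivative_def] assms(1)]
  by (simp add: has_vector_derivative_def scaleR_add_right)

lemma has_pd_reflect:
  assumes "has_pd A (reflect z0 p) a b"
  shows "has_pd (\<lambda>q. A (reflect z0 q)) p (- a) b"
proof -
  have "(reflect z0 has_derivative (\<lambda>h. (- fst h, snd h))) (at p)"
    unfolding reflect_def by (auto intro!: derivative_eq_intros)
  from has_derivative_compose[OF this assms] show ?thesis by simp
qed

lemma C1_on_differentiable: "C1_on D A \<Longrightarrow> open D \<Longrightarrow> p \<in> D \<Longrightarrow> A differentiable (at p)"
  unfolding C1_on_def differentiable_on_def by (metis at_within_open)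

lemma C1_on_has_pd: "C1_on D A \<Longrightarrow> open D \<Longrightarrow> p \<in> D \<Longrightarrow> has_pd A p (pd_z A p) (pd_rho A p)"
  by (intro differentiable_has_pd C1_on_differentiable)

lemma C1_on_continuous: "C1_on D A \<Longrightarrow> continuous_on D A"
  unfolding C1_on_def by (auto intro: differentiable_imp_continuous_on)

lemma C1_onI:
  assumes "open D" "\<And>p. p \<in> D \<Longrightarrow> has_pd A p (a p) (b p)" "continuous_on D a" "continuous_on D b"
  shows "C1_on D A"
  unfolding C1_on_def
proof (intro conjI)
  show "A differentiable_on D"
    using has_pd_imp(3)[OF assms(2)] by (auto simp: differentiable_on_def intro: differentiable_at_withinI)
  show "continuous_on D (pd_z A)" "continuous_on D (pd_rho A)"
    using assms(3,4) has_pd_imp(1,2)[OF assms(2)] by (auto cong: continuous_on_cong)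
qed

lemma constant_if_pd_zero:
  assumes "open D" "connected D" "\<And>p. p \<in> D \<Longrightarrow> has_pd A p 0 0" "p \<in> D" "q \<in> D"
  shows "A p = A q"
  by (rule has_derivative_zero_unique_connected[OF assms(1,2) _ assms(4,5)]) (use assms(3) in simp)

text \<open>Young's argument: the mean value inequality in the first variable replaces
  \<open>A\<close> by \<open>B\<close>, whose increment in the second variable is read off from the
  derivative of \<open>B\<close> at the single point \<open>p\<close>.\<close>

lemma second_difference:
  fixes A B :: "real \<times> real \<Rightarrow> 'a::real_normed_vector"
  assumes B: "\<And>q. q \<in> ball p d \<Longrightarrow> ((\<lambda>s. A (s, snd q)) has_vector_derivative B q) (at (fst q))"
    and L: "(B has_derivative L) (at p)" and d: "d > 0" and e: "e > 0"
  shows "\<exists>\<delta>>0. \<forall>t. 0 < t \<and> t < \<delta> \<longrightarrow>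
    norm (A (fst p + t, snd p + t) - A (fst p + t, snd p) - A (fst p, snd p + t) + A p - t\<^sup>2 *\<^sub>R L (0, 1)) \<le> e * t\<^sup>2"
proof -
  interpret L: bounded_linear L using L by (rule has_derivative_bounded_linear)
  \<comment> \<open>The third of \<open>e\<close> covers both heights below: the errors
    \<open>e / 3 * (2 * t)\<close> at height \<open>t\<close> and \<open>e / 3 * t\<close> at height
    0 add up to \<open>e * t\<close>.\<close>
  obtain d' where d': "d' > 0" "\<And>y. norm (y - p) < d' \<Longrightarrow> norm (B y - B p - L (y - p)) \<le> e / 3 * norm (y - p)"
    using L e unfolding has_derivative_at_alt by (metis divide_pos_pos zero_less_numeral)
  define \<delta> where "\<delta> = min d d' / 2"
  show ?thesis
  proof (intro exI[of _ \<delta>] conjI allI impI)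
    show "\<delta> > 0" using d d' by (simp add: \<delta>_def)
    fix t :: real assume t: "0 < t \<and> t < \<delta>"
    have small: "norm ((s, r) :: real \<times> real) \<le> 2 * t" if "s \<in> {0..t}" "r \<in> {0..t}" for s r
      using norm_Pair_le[of s r] that by auto
    have small': "norm ((s, r) :: real \<times> real) < d" "norm ((s, r) :: real \<times> real) < d'"
      if "s \<in> {0..t}" "r \<in> {0..t}" for s r
      using small[OF that] t by (auto simp: \<delta>_def)
    let ?\<phi> = "\<lambda>s. A (fst p + s, snd p + t) - A (fst p + s, snd p) - (s * t) *\<^sub>R L (0, 1)"
    let ?\<phi>' = "\<lambda>s. B (fst p + s, snd p + t) - B (fst p + s, snd p) - t *\<^sub>R L (0, 1)"
    have "norm (?\<phi> t - ?\<phi> 0) \<le> (e * t) * norm (t - 0)"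
    proof (rule differentiable_bound[where S="{0..t}" and f'="\<lambda>s h. h *\<^sub>R ?\<phi>' s"])
      fix s assume s: "s \<in> {0..t}"
      have D: "((\<lambda>s. A (fst p + s, snd p + r)) has_vector_derivative B (fst p + s, snd p + r)) (at s within {0..t})"
        if r: "r \<in> {0..t}" for r
      proof -
        have "(fst p + s, snd p + r) \<in> ball p d"
          using small'(1)[OF s r] by (cases p) (simp add: dist_norm norm_Pair)
        from B[OF this] have "((\<lambda>s. A (s, snd p + r)) has_vector_derivative B (fst p + s, snd p + r)) (at (fst p + s))"
          by simp
        moreover have "((\<lambda>s. fst p + s) has_vector_derivative 1) (at s within {0..t})"
          by (auto intro!: derivative_eq_intros)
        ultimately show ?thesis
          using vector_diff_chain_within[of "\<lambda>s. fst p + s" 1 s "{0..t}" "\<lambda>s. A (s, snd p + r)"]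
          by (auto simp: o_def intro: has_vector_derivative_at_within)
      qed
      have "(?\<phi> has_vector_derivative ?\<phi>' s) (at s within {0..t})"
        using D[of t] D[of 0] t by (auto intro!: derivative_eq_intros)
      then show "(?\<phi> has_derivative (\<lambda>h. h *\<^sub>R ?\<phi>' s)) (at s within {0..t})"
        by (simp add: has_vector_derivative_def)
      have err: "norm (B (fst p + s, snd p + r) - B p - L (s, r)) \<le> e / 3 * norm ((s, r) :: real \<times> real)"
        if "r \<in> {0..t}" for r
        using d'(2)[of "(fst p + s, snd p + r)"] small'(2)[OF s that] by (cases p) simp
      have "norm (B (fst p + s, snd p + t) - B p - L (s, t)) \<le> e / 3 * (2 * t)"
        using e small[OF s, of t] t by (intro order_trans[OF err] mult_left_mono) auto
      moreover have "norm (B (fst p + s, snd p) - B p - L (s, 0)) \<le> e / 3 * t"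
      proof -
        have "e * s \<le> e * t" using e s by (intro mult_left_mono) auto
        then show ?thesis using s t err[of 0] by (simp add: norm_Pair)
      qed
      moreover have "?\<phi>' s = (B (fst p + s, snd p + t) - B p - L (s, t)) - (B (fst p + s, snd p) - B p - L (s, 0))"
      proof -
        have "L (s, t) = L ((s, 0) + t *\<^sub>R (0, 1))" by simp
        then have "L (s, t) = L (s, 0) + t *\<^sub>R L (0, 1)" by (simp only: L.add L.scaleR)
        then show ?thesis by simp
      qed
      ultimately have "norm (?\<phi>' s) \<le> e / 3 * (2 * t) + e / 3 * t"
        by (metis add_mono norm_triangle_le_diff)
      then have "norm (?\<phi>' s) \<le> e * t" by simp
      then show "onorm (\<lambda>h. h *\<^sub>R ?\<phi>' s) \<le> e * t"
        using e t by (intro onorm_bound) (auto simp: mult.commute[of "e * t"] intro: mult_left_mono)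
    qed (use t in auto)
    moreover have "?\<phi> t - ?\<phi> 0 = A (fst p + t, snd p + t) - A (fst p + t, snd p) - A (fst p, snd p + t) + A p - t\<^sup>2 *\<^sub>R L (0, 1)"
      by (simp add: power2_eq_square)
    ultimately show "norm (A (fst p + t, snd p + t) - A (fst p + t, snd p) - A (fst p, snd p + t) + A p - t\<^sup>2 *\<^sub>R L (0, 1)) \<le> e * t\<^sup>2"
      using t by (simp only:) (simp add: power2_eq_square mult.assoc)
  qed
qed

text \<open>The second difference over a square is symmetric in the two variables, so both orders of
  differentiation approximate the same quantity, each up to
  \<open>e / 2 * t\<^sup>2\<close>.\<close>

lemma mixed_partials:
  assumes D: "open D" and A: "C2_on D A" and p: "p \<in> D"
  shows "pd_rho (pd_z A) p = pd_z (pd_rho A) p"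
proof -
  obtain d where d: "d > 0" "ball p d \<subseteq> D" using D p openE by blast
  have C1: "C1_on D A" "C1_on D (pd_z A)" "C1_on D (pd_rho A)" using A by (auto simp: C2_on_def)
  let ?a = "pd_rho (pd_z A) p" and ?b = "pd_z (pd_rho A) p"
  have "norm (?a - ?b) \<le> e" if e: "e > 0" for e
  proof -
    have 1: "\<exists>\<delta>>0. \<forall>t. 0 < t \<and> t < \<delta> \<longrightarrow>
      norm (A (fst p + t, snd p + t) - A (fst p + t, snd p) - A (fst p, snd p + t) + A p
        - t\<^sup>2 *\<^sub>R (fst (0::real, 1::real) *\<^sub>R pd_z (pd_z A) p + snd (0::real, 1::real) *\<^sub>R pd_rho (pd_z A) p)) \<le> e / 2 * t\<^sup>2"
    proof (rule second_difference[OF _ C1_on_has_pd[OF C1(2) D p] d(1)])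
      fix q assume "q \<in> ball p d"
      then have "q \<in> D" using d by auto
      then have "has_pd A (fst q, snd q) (pd_z A q) (pd_rho A q)" using C1_on_has_pd[OF C1(1) D] by simp
      moreover have "((\<lambda>s. (s, snd q)) has_vector_derivative (1, 0)) (at (fst q))"
        by (auto intro!: derivative_eq_intros simp: has_vector_derivative_def)
      ultimately show "((\<lambda>s. A (s, snd q)) has_vector_derivative pd_z A q) (at (fst q))"
        using has_pd_chain[where g="\<lambda>s. (s, snd q)" and t="fst q" and v="(1, 0)" and S=UNIV] by simp
    qed (use e in simp)
    have swap: "dist (snd q, fst q) (snd p, fst p) = dist q p" for q
      by (cases p; cases q) (simp add: dist_Pair_Pair add.commute)
    \<comment> \<open>The other order is the same estimate for \<open>A\<close> with exchanged
      arguments, at the exchanged point.\<close>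
    have dB: "((\<lambda>q. pd_rho A (snd q, fst q)) has_derivative
        (\<lambda>h. snd h *\<^sub>R pd_z (pd_rho A) p + fst h *\<^sub>R pd_rho (pd_rho A) p)) (at (snd p, fst p))"
    proof -
      have "((\<lambda>q. (snd q, fst q)) has_derivative (\<lambda>h. (snd h, fst h))) (at (snd p, fst p))"
        by (auto intro!: derivative_eq_intros)
      moreover have "has_pd (pd_rho A) (snd (snd p, fst p), fst (snd p, fst p)) (pd_z (pd_rho A) p) (pd_rho (pd_rho A) p)"
        using C1_on_has_pd[OF C1(3) D p] by simp
      ultimately show ?thesis using has_derivative_compose by fastforce
    qed
    have dA: "((\<lambda>s. A (snd (s, snd q), fst (s, snd q))) has_vector_derivative pd_rho A (snd q, fst q)) (at (fst q))"
      if "q \<in> ball (snd p, fst p) d" for q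
    proof -
      have "(snd q, fst q) \<in> ball p d" using that swap[of "(snd q, fst q)"] by (simp add: dist_commute)
      then have "(snd q, fst q) \<in> D" using d by blast
      then have 1: "has_pd A (snd q, fst q) (pd_z A (snd q, fst q)) (pd_rho A (snd q, fst q))"
        by (rule C1_on_has_pd[OF C1(1) D])
      have 2: "((\<lambda>s. (snd q, s)) has_vector_derivative (0, 1)) (at (fst q))"
        by (auto intro!: derivative_eq_intros simp: has_vector_derivative_def)
      show ?thesis using has_pd_chain[OF 1 2] by simp
    qed
    have "e / 2 > 0" using e by simp
    from second_difference[where A="\<lambda>q. A (snd q, fst q)", OF dA dB d(1) this]
    have 2: "\<exists>\<delta>>0. \<forall>t. 0 < t \<and> t < \<delta> \<longrightarrow>
      norm (A (fst p + t, snd p + t) - A (fst p, snd p + t) - A (fst p + t, snd p) + A (fst p, snd p)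
        - t\<^sup>2 *\<^sub>R (1 *\<^sub>R pd_z (pd_rho A) p + 0 *\<^sub>R pd_rho (pd_rho A) p)) \<le> e / 2 * t\<^sup>2"
      by (simp only: fst_conv snd_conv)
    obtain \<delta>1 where \<delta>1: "\<delta>1 > 0" "\<And>t. 0 < t \<Longrightarrow> t < \<delta>1 \<Longrightarrow>
        norm (A (fst p + t, snd p + t) - A (fst p + t, snd p) - A (fst p, snd p + t) + A p - t\<^sup>2 *\<^sub>R ?a) \<le> e / 2 * t\<^sup>2"
      using 1 by auto
    obtain \<delta>2 where \<delta>2: "\<delta>2 > 0" "\<And>t. 0 < t \<Longrightarrow> t < \<delta>2 \<Longrightarrow>
        norm (A (fst p + t, snd p + t) - A (fst p, snd p + t) - A (fst p + t, snd p) + A p - t\<^sup>2 *\<^sub>R ?b) \<le> e / 2 * t\<^sup>2"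
      using 2 by auto
    define t where "t = min \<delta>1 \<delta>2 / 2"
    have t: "0 < t" "t < \<delta>1" "t < \<delta>2" using \<delta>1(1) \<delta>2(1) by (auto simp: t_def)
    let ?d = "A (fst p + t, snd p + t) - A (fst p, snd p + t) - A (fst p + t, snd p) + A p"
    have "norm (?d - t\<^sup>2 *\<^sub>R ?a) \<le> e / 2 * t\<^sup>2" using \<delta>1(2)[OF t(1,2)] by (simp add: algebra_simps)
    moreover have "norm (?d - t\<^sup>2 *\<^sub>R ?b) \<le> e / 2 * t\<^sup>2" using \<delta>2(2)[OF t(1,3)] by simp
    ultimately have "norm ((?d - t\<^sup>2 *\<^sub>R ?b) - (?d - t\<^sup>2 *\<^sub>R ?a)) \<le> e / 2 * t\<^sup>2 + e / 2 * t\<^sup>2"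
      by (intro norm_triangle_le_diff) auto
    moreover have "(?d - t\<^sup>2 *\<^sub>R ?b) - (?d - t\<^sup>2 *\<^sub>R ?a) = t\<^sup>2 *\<^sub>R (?a - ?b)" by (simp add: scaleR_diff_right)
    ultimately have "t\<^sup>2 * norm (?a - ?b) \<le> t\<^sup>2 * e" by (simp add: mult.commute)
    then show ?thesis using t(1) by simp
  qed
  then have "norm (?a - ?b) \<le> 0" by (meson dense_ge)
  then show ?thesis by simp
qed

section \<open>Stability of C1 and C2 under linear maps, differences and reflection\<close>

lemma C1_on_cong:
  assumes "open D" "C1_on D A" "\<And>q. q \<in> D \<Longrightarrow> A q = B q"
  shows "C1_on D B"
  by (rule C1_onI[OF assms(1) has_pd_cong[OF C1_on_has_pd[OF assms(2,1)] assms(1) _ assms(3)]])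
    (use assms(2) in \<open>auto simp: C1_on_def\<close>)

lemma C2_onI:
  assumes D: "open D" and A: "\<And>p. p \<in> D \<Longrightarrow> has_pd A p (a p) (b p)" and "C1_on D a" "C1_on D b"
  shows "C2_on D A"
  unfolding C2_on_def
proof (intro conjI)
  show "C1_on D A"
    by (rule C1_onI[OF D A]) (use assms C1_on_continuous in auto)
  show "C1_on D (pd_z A)" "C1_on D (pd_rho A)"
    using assms(3,4) has_pd_imp(1,2)[OF A] by (auto intro: C1_on_cong[OF D])
qed

lemma C1_on_linear:
  assumes "bounded_linear L" "open D" "C1_on D A"
  shows "C1_on D (\<lambda>q. L (A q))"
  by (rule C1_onI[OF assms(2) has_pd_linear[OF assms(1) C1_on_has_pd[OF assms(3,2)]]])
    (use assms in \<open>auto simp: C1_on_def intro: bounded_linear.continuous_on\<close>)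

lemma C1_on_diff:
  assumes "open D" "C1_on D A" "C1_on D B"
  shows "C1_on D (\<lambda>q. A q - B q)"
  by (rule C1_onI[OF assms(1) has_pd_diff[OF C1_on_has_pd[OF assms(2,1)] C1_on_has_pd[OF assms(3,1)]]])
    (use assms in \<open>auto simp: C1_on_def intro!: continuous_intros\<close>)

lemma C2_on_linear:
  assumes "bounded_linear L" "open D" "C2_on D A"
  shows "C2_on D (\<lambda>q. L (A q))"
  by (rule C2_onI[OF assms(2) has_pd_linear[OF assms(1) C1_on_has_pd[OF _ assms(2)]]])
    (use assms in \<open>auto simp: C2_on_def intro: C1_on_linear\<close>)

lemma C2_on_diff:
  assumes "open D" "C2_on D A" "C2_on D B"
  shows "C2_on D (\<lambda>q. A q - B q)"
  by (rule C2_onI[OF assms(1) has_pd_diff[OF C1_on_has_pd[OF _ assms(1)] C1_on_has_pd[OF _ assms(1)]]])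
    (use assms in \<open>auto simp: C2_on_def intro: C1_on_diff\<close>)

lemma C1_on_reflect:
  assumes D: "open D" "\<And>p. p \<in> D \<Longrightarrow> reflect z0 p \<in> D" and A: "C1_on D A"
  shows "C1_on D (\<lambda>q. A (reflect z0 q))"
proof (rule C1_onI[OF D(1)])
  show "has_pd (\<lambda>q. A (reflect z0 q)) p (- pd_z A (reflect z0 p)) (pd_rho A (reflect z0 p))" if "p \<in> D" for p
    by (rule has_pd_reflect[OF C1_on_has_pd[OF A D(1) D(2)[OF that]]])
  have "continuous_on D (reflect z0)" unfolding reflect_def by (intro continuous_intros)
  then show "continuous_on D (\<lambda>p. - pd_z A (reflect z0 p))" "continuous_on D (\<lambda>p. pd_rho A (reflect z0 p))"
    using A D by (auto simp: C1_on_def intro!: continuous_intros intro: continuous_on_compose2)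
qed

lemma C2_on_reflect:
  assumes D: "open D" "\<And>p. p \<in> D \<Longrightarrow> reflect z0 p \<in> D" and A: "C2_on D A"
  shows "C2_on D (\<lambda>q. A (reflect z0 q))"
proof (rule C2_onI[OF D(1)])
  have C1: "C1_on D A" "C1_on D (pd_z A)" "C1_on D (pd_rho A)" using A by (auto simp: C2_on_def)
  show "has_pd (\<lambda>q. A (reflect z0 q)) p (- pd_z A (reflect z0 p)) (pd_rho A (reflect z0 p))" if "p \<in> D" for p
    by (rule has_pd_reflect[OF C1_on_has_pd[OF C1(1) D(1) D(2)[OF that]]])
  show "C1_on D (\<lambda>p. - pd_z A (reflect z0 p))"
    by (rule C1_on_linear[OF _ D(1) C1_on_reflect[OF D C1(2)]])
      (rule bounded_linear_minus[OF bounded_linear_ident])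
  show "C1_on D (\<lambda>p. pd_rho A (reflect z0 p))" by (rule C1_on_reflect[OF D C1(3)])
qed

section \<open>Unique continuation\<close>

text \<open>\<open>Y\<close> is a field on a strip, periodic in \<open>s\<close>, with \<open>Y\<^sub>t = M + O(Y)\<close>, where \<open>M = - J \<partial>\<^sub>s Y\<close> is a
  symmetric operator applied to \<open>Y\<close>. The energy \<open>H(t) = \<integral> \<bar>Y(t, s)\<bar>\<^sup>2 ds\<close> then is almost logarithmically convex: the
  frequency \<open>N = \<langle>M, Y\<rangle> / H\<close> satisfies \<open>N' \<ge> - K\<^sup>2/2\<close>, which bounds \<open>H'/H\<close> from above and so
  prevents \<open>H\<close> from leaving the value \<open>0\<close>.\<close>

locale strip_flow =
  fixes J :: "'a::euclidean_space \<Rightarrow> 'a" and Y Yt Ys :: "real \<Rightarrow> real \<Rightarrow> 'a" and a b c K :: real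
  assumes J: "bounded_linear J"
    and J_skew: "J x \<bullet> y = - (x \<bullet> J y)"
    and c_pos: "0 < c"
    and Yt: "\<lbrakk>t \<in> {a..b}; s \<in> {0..c}\<rbrakk> \<Longrightarrow>
      ((\<lambda>t. Y t s) has_vector_derivative Yt t s) (at t within {a..b})"
    and Ys: "\<lbrakk>t \<in> {a..b}; s \<in> {0..c}\<rbrakk> \<Longrightarrow> (Y t has_vector_derivative Ys t s) (at s within {0..c})"
    and contY: "continuous_on ({a..b} \<times> {0..c}) (\<lambda>(t, s). Y t s)"
    and contYt: "continuous_on ({a..b} \<times> {0..c}) (\<lambda>(t, s). Yt t s)"
    and contYs: "continuous_on ({a..b} \<times> {0..c}) (\<lambda>(t, s). Ys t s)"
    and periodic: "t \<in> {a..b} \<Longrightarrow> Y t 0 = Y t c"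
    and bound: "\<lbrakk>t \<in> {a..b}; s \<in> {0..c}\<rbrakk> \<Longrightarrow> norm (Yt t s + J (Ys t s)) \<le> K * norm (Y t s)"
begin

definition M :: "real \<Rightarrow> real \<Rightarrow> 'a" where "M t s = - J (Ys t s)"

definition ip :: "(real \<Rightarrow> 'a) \<Rightarrow> (real \<Rightarrow> 'a) \<Rightarrow> real" where
  "ip u v = integral {0..c} (\<lambda>s. u s \<bullet> v s)"

abbreviation cont :: "(real \<Rightarrow> 'a) \<Rightarrow> bool" where "cont u \<equiv> continuous_on {0..c} u"

section \<open>The pairing over one period and its time derivative\<close>

lemma int_ip: "cont u \<Longrightarrow> cont v \<Longrightarrow> (\<lambda>s. u s \<bullet> v s) integrable_on {0..c}"
  by (intro integrable_continuous_real continuous_intros)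

lemma ip_has_integral: "cont u \<Longrightarrow> cont v \<Longrightarrow> ((\<lambda>s. u s \<bullet> v s) has_integral ip u v) {0..c}"
  unfolding ip_def by (intro integrable_integral int_ip)

lemma ip_commute: "ip u v = ip v u"
  by (simp add: ip_def inner_commute)

lemma ip_diff: "cont u \<Longrightarrow> cont v \<Longrightarrow> cont w \<Longrightarrow> ip (\<lambda>s. u s - v s) w = ip u w - ip v w"
  unfolding ip_def inner_diff_left by (intro integral_diff int_ip)

text \<open>Holds for every \<open>u\<close>, since the integral of a non-integrable function is 0
  by convention.\<close>

lemma ip_nonneg: "0 \<le> ip u u"
  unfolding ip_def by (cases "(\<lambda>s. u s \<bullet> u s) integrable_on {0..c}")
    (auto intro: integral_nonneg simp: not_integrable_integral)

lemma cont_section: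
  assumes "continuous_on ({a..b} \<times> {0..c}) (\<lambda>(t, s). F t s)" "t \<in> {a..b}"
  shows "continuous_on {0..c} (F t)"
proof -
  have "continuous_on {0..c} (\<lambda>s. case (t, s) of (t, s) \<Rightarrow> F t s)"
    by (rule continuous_on_compose2[OF assms(1)]) (use assms(2) in \<open>auto intro: continuous_intros\<close>)
  then show ?thesis by simp
qed

lemma contM: "continuous_on ({a..b} \<times> {0..c}) (\<lambda>(t, s). M t s)"
  unfolding M_def using bounded_linear.continuous_on[OF J contYs]
  by (auto simp: case_prod_unfold intro!: continuous_intros)

lemma cont_YM:
  assumes "t \<in> {a..b}" shows "cont (Y t)" "cont (Yt t)" "cont (M t)"
  using cont_section contY contYt contM assms by auto

text \<open>Integration by parts in \<open>s\<close>: as \<open>J\<close> is skew, the difference of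
  the integrands is the derivative of \<open>J (Y t s) \<bullet> Y r s\<close>, and periodicity
  cancels the end values. Two times occur because the product rule for \<open>ip (M t) (Y t)\<close>
  compares \<open>t\<close> with a fixed \<open>r\<close>.\<close>

lemma M_symmetric:
  assumes t: "t \<in> {a..b}" and r: "r \<in> {a..b}"
  shows "ip (M t) (Y r) = ip (Y t) (M r)"
proof -
  have "((\<lambda>s. Y t s \<bullet> M r s - M t s \<bullet> Y r s) has_integral (J (Y t c) \<bullet> Y r c - J (Y t 0) \<bullet> Y r 0)) {0..c}"
  proof (rule fundamental_theorem_of_calculus)
    fix s assume s: "s \<in> {0..c}"
    have 1: "((\<lambda>s. J (Y t s)) has_vector_derivative J (Ys t s)) (at s within {0..c})"
      by (rule bounded_linear.has_vector_derivative[OF J Ys[OF t s]])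
    have "((\<lambda>s. J (Y t s) \<bullet> Y r s) has_vector_derivative
        (J (Y t s) \<bullet> Ys r s + J (Ys t s) \<bullet> Y r s)) (at s within {0..c})"
      by (rule bounded_bilinear.has_vector_derivative[OF bounded_bilinear_inner 1 Ys[OF r s]])
    moreover have "J (Y t s) \<bullet> Ys r s = Y t s \<bullet> M r s"
      unfolding M_def by (simp add: J_skew)
    ultimately show "((\<lambda>s. J (Y t s) \<bullet> Y r s) has_vector_derivative
        (Y t s \<bullet> M r s - M t s \<bullet> Y r s)) (at s within {0..c})"
      by (simp add: M_def)
  qed (use c_pos in simp)
  then have "((\<lambda>s. Y t s \<bullet> M r s - M t s \<bullet> Y r s) has_integral 0) {0..c}"
    using periodic[OF t] periodic[OF r] by simp
  then have "integral {0..c} (\<lambda>s. Y t s \<bullet> M r s - M t s \<bullet> Y r s) = 0"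
    by (rule integral_unique)
  moreover have "integral {0..c} (\<lambda>s. Y t s \<bullet> M r s - M t s \<bullet> Y r s) = ip (Y t) (M r) - ip (M t) (Y r)"
    unfolding ip_def by (intro integral_diff int_ip cont_YM t r)
  ultimately show ?thesis by simp
qed

lemma deriv_ip_const:
  assumes r: "r \<in> {a..b}" and v: "cont v"
  shows "((\<lambda>t. ip (Y t) v) has_real_derivative ip (Yt r) v) (at r within {a..b})"
proof -
  have "((\<lambda>t. integral (cbox 0 c) (\<lambda>s. Y t s \<bullet> v s)) has_real_derivative
      integral (cbox 0 c) (\<lambda>s. Yt r s \<bullet> v s)) (at r within {a..b})"
  proof (rule leibniz_rule_field_derivative)
    fix t s assume "t \<in> {a..b}" "s \<in> cbox 0 c"
    then have "((\<lambda>t. Y t s) has_vector_derivative Yt t s) (at t within {a..b})" using Yt by simp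
    from bounded_linear.has_vector_derivative[OF bounded_linear_inner_left this]
    show "((\<lambda>t. Y t s \<bullet> v s) has_real_derivative Yt t s \<bullet> v s) (at t within {a..b})"
      by (simp add: has_real_derivative_iff_has_vector_derivative)
  next
    show "(\<lambda>s. Y t s \<bullet> v s) integrable_on cbox 0 c" if "t \<in> {a..b}" for t
      using int_ip[OF cont_YM(1)[OF that] v] by simp
    have "continuous_on ({a..b} \<times> {0..c}) (\<lambda>x. v (snd x))"
      by (rule continuous_on_compose2[OF v]) (auto intro: continuous_intros)
    then show "continuous_on ({a..b} \<times> cbox 0 c) (\<lambda>(t, s). Yt t s \<bullet> v s)"
      using contYt by (auto simp: case_prod_unfold intro!: continuous_intros)
  qed (use r in auto)
  then show ?thesis by (simp add: ip_def)
qed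

text \<open>The product rule for \<open>\<integral> Z \<bullet> Y\<close> when \<open>Z\<close> is merely continuous in \<open>t\<close>: the increment of \<open>Y\<close> times the
  increment of \<open>Z\<close> is of second order.\<close>

lemma deriv_ip_increments:
  assumes r: "r \<in> {a..b}"
    and contZ: "continuous_on ({a..b} \<times> {0..c}) (\<lambda>(t, s). Z t s)"
  shows "((\<lambda>t. ip (\<lambda>s. Y t s - Y r s) (\<lambda>s. Z t s - Z r s)) has_real_derivative 0) (at r within {a..b})"
    (is "(?g has_real_derivative _) _")
proof -
  let ?S = "{a..b} \<times> {0..c}"
  have comp: "compact ?S" by (intro compact_Times compact_Icc)
  obtain L where L: "L > 0" "\<And>t s. t \<in> {a..b} \<Longrightarrow> s \<in> {0..c} \<Longrightarrow> norm (Yt t s) \<le> L"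
  proof -
    have "bounded ((\<lambda>(t, s). Yt t s) ` ?S)"
      by (rule compact_imp_bounded[OF compact_continuous_image[OF contYt comp]])
    then obtain L where "L > 0" "\<forall>x\<in>(\<lambda>(t, s). Yt t s) ` ?S. norm x \<le> L"
      using bounded_pos by blast
    then show ?thesis using that by force
  qed
  have lip: "norm (Y t s - Y r s) \<le> L * \<bar>t - r\<bar>" if t: "t \<in> {a..b}" and s: "s \<in> {0..c}" for t s
  proof -
    have "norm (Y t s - Y r s) \<le> L * norm (t - r)"
    proof (rule differentiable_bound[where S="{a..b}" and f="\<lambda>t. Y t s" and f'="\<lambda>t h. h *\<^sub>R Yt t s"])
      show "onorm (\<lambda>h. h *\<^sub>R Yt u s) \<le> L" if "u \<in> {a..b}" for u
        using L(1) L(2)[OF that s] by (intro onorm_bound) (auto simp: mult.commute[of L] intro: mult_left_mono)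
    qed (use Yt s t r in \<open>auto simp: has_vector_derivative_def\<close>)
    then show ?thesis by simp
  qed
  have unif: "\<exists>d>0. \<forall>t\<in>{a..b}. \<bar>t - r\<bar> < d \<longrightarrow> \<bar>?g t\<bar> \<le> e * \<bar>t - r\<bar>" if e: "e > 0" for e
  proof -
    \<comment> \<open>\<open>L\<close> is the Lipschitz constant of \<open>Y\<close> in time and
      \<open>c\<close> the length of the period; integrating
      \<open>L * \<bar>t - r\<bar> * ?e\<close> over the period gives back
      \<open>e * \<bar>t - r\<bar>\<close>.\<close>
    let ?e = "e / (L * c)"
    have e': "?e > 0" using e L c_pos by simp
    have "uniformly_continuous_on ?S (\<lambda>(t, s). Z t s)"
      by (rule compact_uniformly_continuous[OF contZ comp])
    then obtain d where d: "d > 0" "\<And>x x'. x \<in> ?S \<Longrightarrow> x' \<in> ?S \<Longrightarrow> dist x' x < d \<Longrightarrow>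
        dist (case x' of (t, s) \<Rightarrow> Z t s) (case x of (t, s) \<Rightarrow> Z t s) < ?e"
      using e' unfolding uniformly_continuous_on_def by metis
    show ?thesis
    proof (intro exI[of _ d] conjI ballI impI)
      fix t assume t: "t \<in> {a..b}" and td: "\<bar>t - r\<bar> < d"
      have "norm (?g t) \<le> (L * \<bar>t - r\<bar> * ?e) * (c - 0)"
        unfolding ip_def
      proof (rule integral_bound)
        show "continuous_on {0..c} (\<lambda>s. (Y t s - Y r s) \<bullet> (Z t s - Z r s))"
          by (intro continuous_intros cont_YM cont_section[OF contZ] t r)
        fix s assume s: "s \<in> {0..c}"
        have "norm (Z t s - Z r s) \<le> ?e"
          using d(2)[of "(r, s)" "(t, s)"] t r s td by (simp add: dist_norm dist_Pair_Pair)
        then have "norm (Y t s - Y r s) * norm (Z t s - Z r s) \<le> (L * \<bar>t - r\<bar>) * ?e"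
          using lip[OF t s] L(1) by (intro mult_mono) auto
        then show "norm ((Y t s - Y r s) \<bullet> (Z t s - Z r s)) \<le> L * \<bar>t - r\<bar> * ?e"
          using Cauchy_Schwarz_ineq2[of "Y t s - Y r s" "Z t s - Z r s"] by simp
      qed (use c_pos in simp)
      also have "\<dots> = e * \<bar>t - r\<bar>" using L c_pos by (simp add: field_simps)
      finally show "\<bar>?g t\<bar> \<le> e * \<bar>t - r\<bar>" by simp
    qed (rule d(1))
  qed
  have g0: "?g r = 0" by (simp add: ip_def)
  show ?thesis
    unfolding has_field_derivative_def has_derivative_within_alt
    using unif g0 by (auto intro: bounded_linear_mult_right)
qed

lemma deriv_ip_self:
  assumes r: "r \<in> {a..b}"
  shows "((\<lambda>t. ip (Y t) (Y t)) has_real_derivative 2 * ip (Yt r) (Y r)) (at r within {a..b})"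
proof -
  \<comment> \<open>Expansion about \<open>r\<close>: the first term pairs \<open>Y t\<close> with a
    frozen field and is differentiated under the integral; the last is of second order.\<close>
  have eq: "ip (Y t) (Y t) = 2 * ip (Y t) (Y r) - ip (Y r) (Y r)
      + ip (\<lambda>s. Y t s - Y r s) (\<lambda>s. Y t s - Y r s)" if t: "t \<in> {a..b}" for t
  proof -
    have "ip (\<lambda>s. Y t s - Y r s) (\<lambda>s. Y t s - Y r s)
      = ip (Y t) (\<lambda>s. Y t s - Y r s) - ip (Y r) (\<lambda>s. Y t s - Y r s)"
      by (intro ip_diff continuous_intros cont_YM t r)
    also have "\<dots> = (ip (Y t) (Y t) - ip (Y t) (Y r)) - (ip (Y t) (Y r) - ip (Y r) (Y r))"
      by (subst (1 2) ip_commute, subst (1 2) ip_diff) (auto intro!: cont_YM t r simp: ip_commute)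
    finally show ?thesis by simp
  qed
  have "((\<lambda>t. 2 * ip (Y t) (Y r) - ip (Y r) (Y r)
      + ip (\<lambda>s. Y t s - Y r s) (\<lambda>s. Y t s - Y r s)) has_real_derivative
      (2 * ip (Yt r) (Y r) - 0 + 0)) (at r within {a..b})"
    by (intro derivative_intros deriv_ip_increments DERIV_cmult deriv_ip_const r cont_YM contY)
  then show ?thesis
    unfolding add_0_right diff_0_right
    by (rule has_field_derivative_transform_within[OF _ zero_less_one r]) (simp only: eq)
qed

lemma deriv_ip_M:
  assumes r: "r \<in> {a..b}"
  shows "((\<lambda>t. ip (M t) (Y t)) has_real_derivative 2 * ip (Yt r) (M r)) (at r within {a..b})"
proof -
  have eq: "ip (M t) (Y t) = 2 * ip (Y t) (M r) - ip (Y r) (M r)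
      + ip (\<lambda>s. Y t s - Y r s) (\<lambda>s. M t s - M r s)" if t: "t \<in> {a..b}" for t
  proof -
    have "ip (\<lambda>s. Y t s - Y r s) (\<lambda>s. M t s - M r s)
      = ip (Y t) (\<lambda>s. M t s - M r s) - ip (Y r) (\<lambda>s. M t s - M r s)"
      by (intro ip_diff continuous_intros cont_YM t r)
    also have "\<dots> = (ip (M t) (Y t) - ip (M r) (Y t)) - (ip (M t) (Y r) - ip (M r) (Y r))"
      by (subst (1 2) ip_commute, subst (1 2) ip_diff) (auto intro!: cont_YM t r)
    also have "ip (M t) (Y r) = ip (M r) (Y t)"
      using M_symmetric[OF t r] by (simp add: ip_commute)
    finally show ?thesis by (simp add: ip_commute)
  qed
  have "((\<lambda>t. 2 * ip (Y t) (M r) - ip (Y r) (M r)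
      + ip (\<lambda>s. Y t s - Y r s) (\<lambda>s. M t s - M r s)) has_real_derivative
      (2 * ip (Yt r) (M r) - 0 + 0)) (at r within {a..b})"
    by (intro derivative_intros deriv_ip_increments DERIV_cmult deriv_ip_const r cont_YM contM)
  then show ?thesis
    unfolding add_0_right diff_0_right
    by (rule has_field_derivative_transform_within[OF _ zero_less_one r]) (simp only: eq)
qed


section \<open>Growth of the energy and of the frequency\<close>

lemma energy_growth:
  assumes t: "t \<in> {a..b}"
  shows "ip (Yt t) (Y t) \<le> ip (M t) (Y t) + K * ip (Y t) (Y t)"
proof -
  have "0 \<le> integral {0..c} (\<lambda>s. M t s \<bullet> Y t s + K * (Y t s \<bullet> Y t s) - Yt t s \<bullet> Y t s)"
  proof (rule integral_nonneg)
    show "(\<lambda>s. M t s \<bullet> Y t s + K * (Y t s \<bullet> Y t s) - Yt t s \<bullet> Y t s) integrable_on {0..c}"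
      by (intro integrable_continuous_real continuous_intros cont_YM t)
    fix s assume s: "s \<in> {0..c}"
    have "(Yt t s - M t s) \<bullet> Y t s \<le> norm (Yt t s - M t s) * norm (Y t s)"
      by (rule norm_cauchy_schwarz)
    also have "\<dots> \<le> (K * norm (Y t s)) * norm (Y t s)"
      using bound[OF t s] by (intro mult_right_mono) (auto simp: M_def)
    finally show "0 \<le> M t s \<bullet> Y t s + K * (Y t s \<bullet> Y t s) - Yt t s \<bullet> Y t s"
      by (simp add: inner_diff_left dot_square_norm power2_eq_square)
  qed
  also have "\<dots> = ip (M t) (Y t) + K * ip (Y t) (Y t) - ip (Yt t) (Y t)"
    by (intro integral_unique has_integral_diff has_integral_add has_integral_mult_right
        ip_has_integral cont_YM t)
  finally show ?thesis by simp
qed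

text \<open>The integrand is \<open>\<bar>(Yt + M)/2 - n Y\<bar>\<^sup>2 + (K\<^sup>2\<bar>Y\<bar>\<^sup>2 - \<bar>Yt - M\<bar>\<^sup>2)/4\<close>.\<close>

lemma frequency_growth:
  assumes t: "t \<in> {a..b}"
  shows "- (K\<^sup>2 / 4) * ip (Y t) (Y t) \<le>
    ip (Yt t) (M t) + n\<^sup>2 * ip (Y t) (Y t) - n * ip (M t) (Y t) - n * ip (Yt t) (Y t)"
proof -
  have "0 \<le> integral {0..c} (\<lambda>s. Yt t s \<bullet> M t s + (n\<^sup>2 + K\<^sup>2 / 4) * (Y t s \<bullet> Y t s)
      - n * (M t s \<bullet> Y t s) - n * (Yt t s \<bullet> Y t s))"
  proof (rule integral_nonneg)
    show "(\<lambda>s. Yt t s \<bullet> M t s + (n\<^sup>2 + K\<^sup>2 / 4) * (Y t s \<bullet> Y t s)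
      - n * (M t s \<bullet> Y t s) - n * (Yt t s \<bullet> Y t s)) integrable_on {0..c}"
      by (intro integrable_continuous_real continuous_intros cont_YM t)
    fix s assume s: "s \<in> {0..c}"
    let ?y = "Y t s" and ?m = "M t s" and ?d = "Yt t s"
    let ?q = "(1/2) *\<^sub>R (?d + ?m) - n *\<^sub>R ?y"
    have "norm (?d - ?m) \<le> K * norm ?y" using bound[OF t s] by (simp add: M_def)
    then have "(norm (?d - ?m))\<^sup>2 \<le> (K * norm ?y)\<^sup>2" by (intro power_mono) auto
    then have 1: "(?d - ?m) \<bullet> (?d - ?m) \<le> K\<^sup>2 * (?y \<bullet> ?y)"
      by (simp add: dot_square_norm power_mult_distrib)
    have "?d \<bullet> ?m + (n\<^sup>2 + K\<^sup>2 / 4) * (?y \<bullet> ?y) - n * (?m \<bullet> ?y) - n * (?d \<bullet> ?y)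
       = ?q \<bullet> ?q + (K\<^sup>2 * (?y \<bullet> ?y) - (?d - ?m) \<bullet> (?d - ?m)) / 4"
      by (simp add: inner_diff_left inner_diff_right inner_add_left inner_add_right inner_commute
          power2_eq_square field_simps)
    then show "0 \<le> ?d \<bullet> ?m + (n\<^sup>2 + K\<^sup>2 / 4) * (?y \<bullet> ?y) - n * (?m \<bullet> ?y) - n * (?d \<bullet> ?y)"
      using 1 inner_ge_zero[of ?q] by (simp only:) (auto intro!: add_nonneg_nonneg)
  qed
  also have "\<dots> = ip (Yt t) (M t) + (n\<^sup>2 + K\<^sup>2 / 4) * ip (Y t) (Y t)
      - n * ip (M t) (Y t) - n * ip (Yt t) (Y t)"
    by (intro integral_unique has_integral_diff has_integral_add has_integral_mult_right
        ip_has_integral cont_YM t)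
  finally show ?thesis by (simp add: algebra_simps)
qed

text \<open>By contradiction, on the interval from the last zero of \<open>H\<close> up to
  \<open>t1\<close>, where \<open>N\<close> makes sense. \<open>N\<close> is bounded above uniformly
  down to that zero, so \<open>H\<close> grows at most exponentially from the value 0.\<close>

lemma no_energy_zero:
  assumes zero: "ip (Y a) (Y a) = 0" and t: "t1 \<in> {a..b}"
  shows "ip (Y t1) (Y t1) = 0"
proof (rule ccontr)
  define H where "H t = ip (Y t) (Y t)" for t
  define N where "N t = ip (M t) (Y t) / H t" for t
  assume "ip (Y t1) (Y t1) \<noteq> 0"
  then have H1: "H t1 > 0" using ip_nonneg[of "Y t1"] by (simp add: H_def)
  have dH: "(H has_real_derivative 2 * ip (Yt t) (Y t)) (at t within {a..b})" if "t \<in> {a..b}" for t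
    unfolding H_def by (rule deriv_ip_self[OF that])
  have contH: "continuous_on {a..b} H"
    using dH by (intro DERIV_continuous_on)
  define Z where "Z = {t \<in> {a..t1}. H t = 0}"
  have sub: "{a..t1} \<subseteq> {a..b}" using t by auto
  have "closed Z" unfolding Z_def
    using continuous_on_subset[OF contH sub] by (intro continuous_closed_preimage_constant) auto
  moreover have "bounded Z"
    by (rule bounded_subset[OF bounded_closed_interval[of a t1]]) (auto simp: Z_def)
  ultimately have Z: "compact Z" by (simp add: compact_eq_bounded_closed)
  have "a \<in> Z" using zero t by (auto simp: Z_def H_def)
  then obtain s0 where s0: "s0 \<in> Z" "\<And>t. t \<in> Z \<Longrightarrow> t \<le> s0"
    using compact_attains_sup[OF Z] by blast
  have s0': "a \<le> s0" "s0 < t1" "H s0 = 0"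
    using s0(1) H1 by (auto simp: Z_def order.strict_iff_order)
  have pos: "H t > 0" if "s0 < t" "t \<le> t1" for t
  proof -
    have "t \<notin> Z" using s0(2)[of t] that by auto
    then have "H t \<noteq> 0" using that s0' by (auto simp: Z_def)
    then show ?thesis using ip_nonneg[of "Y t"] by (simp add: H_def)
  qed
  have dN: "(N has_real_derivative (2 * ip (Yt t) (M t) * H t - ip (M t) (Y t) * (2 * ip (Yt t) (Y t))) / (H t * H t))
      (at t within {a..b})" if "s0 < t" "t \<le> t1" for t
    unfolding N_def using that s0' t pos[OF that]
    by (intro DERIV_divide deriv_ip_M dH) auto
  have N_mono: "N t \<le> N t1 + K\<^sup>2 / 2 * (t1 - s0)" if tt: "s0 < t" "t \<le> t1" for t
  proof -
    have "N t + K\<^sup>2 / 2 * t \<le> N t1 + K\<^sup>2 / 2 * t1"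
    proof (rule DERIV_nonneg_imp_increasing_open[OF tt(2)])
      fix x assume x: "t < x" "x < t1"
      then have xab: "x \<in> {a..b}" and at: "at x within {a..b} = at x" and Hx: "H x > 0"
        using tt s0' t pos by (auto intro: at_within_Icc_at)
      have "(N has_real_derivative (2 * ip (Yt x) (M x) * H x - ip (M x) (Y x) * (2 * ip (Yt x) (Y x))) / (H x * H x)) (at x)"
        using dN[of x] x tt at by simp
      then have "((\<lambda>t. N t + K\<^sup>2 / 2 * t) has_real_derivative
         ((2 * ip (Yt x) (M x) * H x - ip (M x) (Y x) * (2 * ip (Yt x) (Y x))) / (H x * H x) + K\<^sup>2 / 2 * 1)) (at x)"
        by (intro DERIV_add DERIV_cmult DERIV_ident)
      moreover have "0 \<le> (2 * ip (Yt x) (M x) * H x - ip (M x) (Y x) * (2 * ip (Yt x) (Y x))) / (H x * H x) + K\<^sup>2 / 2 * 1"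
      proof -
        \<comment> \<open>For \<open>n = N x\<close> the terms
          \<open>n\<^sup>2 * ip (Y x) (Y x)\<close> and \<open>n * ip (M x) (Y x)\<close> of
          \<open>frequency_growth\<close> cancel; what remains is \<open>H x / 2\<close> times the
          derivative of \<open>N\<close>.\<close>
        have *: "ip (M x) (Y x) = N x * H x" using Hx by (simp add: N_def)
        have "- (K\<^sup>2 / 4) * H x \<le> ip (Yt x) (M x) - N x * ip (Yt x) (Y x)"
          using frequency_growth[OF xab, of "N x"] by (simp add: H_def[symmetric] * power2_eq_square)
        then have "- (K\<^sup>2 / 4) \<le> (ip (Yt x) (M x) - N x * ip (Yt x) (Y x)) / H x"
          using Hx by (simp add: pos_le_divide_eq)
        moreover have "(2 * ip (Yt x) (M x) * H x - ip (M x) (Y x) * (2 * ip (Yt x) (Y x))) / (H x * H x)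
            = 2 * ((ip (Yt x) (M x) - N x * ip (Yt x) (Y x)) / H x)"
          unfolding * using Hx by (simp add: field_simps)
        ultimately show ?thesis by linarith
      qed
      ultimately show "\<exists>y. ((\<lambda>t. N t + K\<^sup>2 / 2 * t) has_real_derivative y) (at x) \<and> 0 \<le> y" by blast
    next
      have "continuous_on {t..t1} N"
      proof (rule DERIV_continuous_on)
        fix x assume "x \<in> {t..t1}"
        then show "(N has_real_derivative (2 * ip (Yt x) (M x) * H x - ip (M x) (Y x) * (2 * ip (Yt x) (Y x))) / (H x * H x))
            (at x within {t..t1})"
          using tt s0' t by (intro DERIV_subset[OF dN]) auto
      qed
      then show "continuous_on {t..t1} (\<lambda>t. N t + K\<^sup>2 / 2 * t)" by (intro continuous_intros)
    qed
    moreover have "K\<^sup>2 / 2 * (t1 - t) \<le> K\<^sup>2 / 2 * (t1 - s0)" using tt by (intro mult_left_mono) auto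
    ultimately show ?thesis unfolding right_diff_distrib by linarith
  qed
  \<comment> \<open>A bound for the logarithmic derivative of \<open>H\<close>: it is at most
    \<open>2 * (N x + K)\<close> by \<open>energy_growth\<close>, and \<open>N_mono\<close> bounds
    \<open>N x\<close>.\<close>
  define A where "A = 2 * (N t1 + K\<^sup>2 / 2 * (t1 - s0) + K)"
  have "H t1 * exp (- A * t1) \<le> H s0 * exp (- A * s0)"
  proof (rule DERIV_nonpos_imp_decreasing_open[OF less_imp_le[OF s0'(2)]])
    fix x assume x: "s0 < x" "x < t1"
    then have xab: "x \<in> {a..b}" and at: "at x within {a..b} = at x" and Hx: "H x > 0"
      using s0' t pos by (auto intro: at_within_Icc_at)
    have "(H has_real_derivative 2 * ip (Yt x) (Y x)) (at x)" using dH[OF xab] at by simp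
    then have "((\<lambda>t. H t * exp (- A * t)) has_real_derivative
        (2 * ip (Yt x) (Y x) - A * H x) * exp (- A * x)) (at x)"
      by (auto intro!: derivative_eq_intros simp: algebra_simps)
    moreover have "2 * ip (Yt x) (Y x) - A * H x \<le> 0"
    proof -
      have "ip (Yt x) (Y x) \<le> N x * H x + K * H x"
        using energy_growth[OF xab] Hx by (simp add: N_def H_def)
      also have "\<dots> \<le> (N t1 + K\<^sup>2 / 2 * (t1 - s0)) * H x + K * H x"
        using N_mono[of x] x Hx by (intro add_right_mono mult_right_mono) auto
      finally have "2 * ip (Yt x) (Y x) \<le> 2 * ((N t1 + K\<^sup>2 / 2 * (t1 - s0)) * H x + K * H x)"
        by (rule mult_left_mono) simp
      also have "\<dots> = A * H x" unfolding A_def by (simp only: distrib_right mult.assoc)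
      finally show ?thesis by simp
    qed
    ultimately show "\<exists>y. ((\<lambda>t. H t * exp (- A * t)) has_real_derivative y) (at x) \<and> y \<le> 0"
      by (meson exp_ge_zero mult_nonpos_nonneg)
  next
    have "continuous_on {s0..t1} H" using s0' t by (intro continuous_on_subset[OF contH]) auto
    then show "continuous_on {s0..t1} (\<lambda>t. H t * exp (- A * t))" by (intro continuous_intros)
  qed
  then show False using H1 s0'(3) by (simp add: mult_le_0_iff)
qed

lemma unique_continuation:
  assumes zero: "\<And>s. s \<in> {0..c} \<Longrightarrow> Y a s = 0" and t: "t \<in> {a..b}" and s: "s \<in> {0..c}"
  shows "Y t s = 0"
proof -
  have "((\<lambda>s. Y a s \<bullet> Y a s) has_integral 0) {0..c}"
    by (rule has_integral_is_0) (simp add: zero)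
  then have "ip (Y a) (Y a) = 0" unfolding ip_def by (rule integral_unique)
  then have 0: "integral {0..c} (\<lambda>s. Y t s \<bullet> Y t s) = 0"
    using no_energy_zero[OF _ t] unfolding ip_def by blast
  have "continuous_on {0..c} (\<lambda>s. Y t s \<bullet> Y t s)"
    by (intro continuous_intros cont_YM t)
  from integral_eq_0_iff[OF this c_pos inner_ge_zero] 0
  have "\<forall>s\<in>{0..c}. Y t s \<bullet> Y t s = 0" by blast
  then show ?thesis using s by simp
qed

end

text \<open>The relation \<open>X\<^sub>z + J X\<^sub>\<rho> = O(X)\<close> keeps its form in logarithmic polar coordinates, in which an
  annulus is a periodic strip.\<close>

lemma disc_unique_continuation:
  fixes X :: "real \<times> real \<Rightarrow> 'a::euclidean_space"
  assumes D: "open D" and X: "C1_on D X" and sub: "cball p0 R \<subseteq> D" and r: "0 < r" "r \<le> R"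
    and J: "bounded_linear J" and J_skew: "\<And>x y. J x \<bullet> y = - (x \<bullet> J y)" and J_sq: "\<And>x. J (J x) = - x"
    and bound: "\<And>p. p \<in> cball p0 R \<Longrightarrow> norm (pd_z X p + J (pd_rho X p)) \<le> C * norm (X p)"
    and zero: "\<And>p. dist p0 p = r \<Longrightarrow> X p = 0"
    and p: "r \<le> dist p0 p" "dist p0 p \<le> R"
  shows "X p = 0"
proof -
  interpret J: bounded_linear J by (rule J)
  define e where "e s = (cos s, sin s)" for s :: real
  define pt where "pt t s = p0 + exp t *\<^sub>R e s" for t s :: real
  define Y where "Y t s = X (pt t s)" for t s
  define Yt where "Yt t s = exp t *\<^sub>R (cos s *\<^sub>R pd_z X (pt t s) + sin s *\<^sub>R pd_rho X (pt t s))" for t s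
  define Ys where "Ys t s = exp t *\<^sub>R (- sin s *\<^sub>R pd_z X (pt t s) + cos s *\<^sub>R pd_rho X (pt t s))" for t s
  have norm_e: "norm (e s) = 1" for s by (simp add: e_def norm_Pair)
  have dist_pt: "dist p0 (pt t s) = exp t" for t s by (simp add: pt_def dist_norm norm_e)
  have norm_J: "norm (J x) = norm x" for x
  proof -
    have "J x \<bullet> J x = x \<bullet> x" by (simp add: J_skew J_sq)
    then show ?thesis by (simp add: norm_eq_sqrt_inner)
  qed
  have Rpos: "0 < R" using r by simp
  have exp_le: "exp t \<le> R" if "t \<in> {ln r..ln R}" for t
    using that Rpos by (metis atLeastAtMost_iff exp_le_cancel_iff exp_ln)
  have pt_in: "pt t s \<in> cball p0 R" if "t \<in> {ln r..ln R}" for t s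
    using exp_le[OF that] by (simp add: dist_pt)
  have cont_pt: "continuous_on S (\<lambda>(t, s). pt t s)" for S
    by (auto simp: pt_def e_def case_prod_unfold intro!: continuous_intros)
  have pt_D: "(\<lambda>(t, s). pt t s) ` ({ln r..ln R} \<times> {0..2 * pi}) \<subseteq> D"
    using pt_in sub by auto
  have comp: "continuous_on ({ln r..ln R} \<times> {0..2 * pi}) (\<lambda>x. F (pt (fst x) (snd x)))"
    if "continuous_on D F" for F :: "real \<times> real \<Rightarrow> 'a"
    using continuous_on_compose2[OF that cont_pt pt_D] by (simp add: case_prod_unfold)
  have cont: "continuous_on D (pd_z X)" "continuous_on D (pd_rho X)"
    using X by (auto simp: C1_on_def)
  \<comment> \<open>In the constant, \<open>R\<close> bounds the factor \<open>exp t\<close>, and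
    the 2 counts the cosine and the sine term.\<close>
  interpret strip_flow J Y Yt Ys "ln r" "ln R" "2 * pi" "2 * R * C"
  proof
    show "J x \<bullet> y = - (x \<bullet> J y)" for x y by (rule J_skew)
  next
    fix t s assume t: "t \<in> {ln r..ln R}"
    have ptD: "pt t s \<in> D" using pt_in[OF t] sub by auto
    note dX = C1_on_has_pd[OF X D ptD]
    have "((\<lambda>t. pt t s) has_vector_derivative exp t *\<^sub>R e s) (at t within {ln r..ln R})"
      unfolding pt_def by (auto intro!: derivative_eq_intros)
    from has_pd_chain[OF dX this]
    show "((\<lambda>t. Y t s) has_vector_derivative Yt t s) (at t within {ln r..ln R})"
      by (simp add: Y_def Yt_def e_def scaleR_add_right)
    have "(e has_vector_derivative (- sin s, cos s)) (at s within {0..2 * pi})"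
      unfolding e_def by (auto intro!: derivative_eq_intros has_vector_derivative_Pair
          simp flip: has_real_derivative_iff_has_vector_derivative)
    then have "(pt t has_vector_derivative exp t *\<^sub>R (- sin s, cos s)) (at s within {0..2 * pi})"
      unfolding pt_def by (auto intro!: derivative_eq_intros)
    from has_pd_chain[OF dX this]
    show "(Y t has_vector_derivative Ys t s) (at s within {0..2 * pi})"
      by (simp add: Y_def[abs_def] Ys_def scaleR_add_right scaleR_diff_right)
    let ?v = "pd_z X (pt t s) + J (pd_rho X (pt t s))"
    \<comment> \<open>With \<open>J\<close> as imaginary unit the right side is \<open>?v\<close>,
      scaled by \<open>exp t\<close> and rotated by the angle \<open>- s\<close>. This is the
      conformal covariance of the operator.\<close>
    have "Yt t s + J (Ys t s) = exp t *\<^sub>R (cos s *\<^sub>R ?v - sin s *\<^sub>R J ?v)"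
      by (simp add: Yt_def Ys_def J.add J.diff J.scaleR J_sq J.neg algebra_simps)
    also have "norm \<dots> \<le> exp t * (norm ?v + norm ?v)"
    proof -
      have "norm (cos s *\<^sub>R ?v - sin s *\<^sub>R J ?v) \<le> norm (cos s *\<^sub>R ?v) + norm (sin s *\<^sub>R J ?v)"
        by (rule norm_triangle_ineq4)
      also have "\<dots> \<le> norm ?v + norm ?v"
        unfolding norm_scaleR norm_J by (intro add_mono mult_left_le_one_le) auto
      finally show ?thesis by simp
    qed
    also have "\<dots> \<le> R * (C * norm (Y t s) + C * norm (Y t s))"
      using exp_le[OF t] bound[OF pt_in[OF t]] Rpos unfolding Y_def by (intro mult_mono add_mono) auto
    finally show "norm (Yt t s + J (Ys t s)) \<le> 2 * R * C * norm (Y t s)" by simp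
  next
    show "Y t 0 = Y t (2 * pi)" for t by (simp add: Y_def pt_def e_def)
    show "continuous_on ({ln r..ln R} \<times> {0..2 * pi}) (\<lambda>(t, s). Y t s)"
      using comp[OF C1_on_continuous[OF X]] by (simp add: Y_def case_prod_unfold)
    show "continuous_on ({ln r..ln R} \<times> {0..2 * pi}) (\<lambda>(t, s). Yt t s)"
      unfolding Yt_def case_prod_unfold by (intro continuous_intros comp cont)
    show "continuous_on ({ln r..ln R} \<times> {0..2 * pi}) (\<lambda>(t, s). Ys t s)"
      unfolding Ys_def case_prod_unfold by (intro continuous_intros comp cont)
  qed (use Rpos in auto)
  have d: "dist p0 p > 0" using p r by linarith
  let ?u = "(1 / dist p0 p) *\<^sub>R (p - p0)"
  have "norm ?u = 1" using d by (simp add: dist_norm norm_minus_commute)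
  then have "(fst ?u)\<^sup>2 + (snd ?u)\<^sup>2 = 1"
    by (simp only: norm_prod_def real_norm_def power2_abs real_sqrt_eq_1_iff)
  then obtain s where s: "0 \<le> s" "s < 2 * pi" "fst ?u = cos s" "snd ?u = sin s"
    using sincos_total_2pi by metis
  have "?u = e s" by (rule prod_eqI) (use s in \<open>auto simp: e_def\<close>)
  then have "dist p0 p *\<^sub>R ?u = dist p0 p *\<^sub>R e s" by simp
  then have "p = pt (ln (dist p0 p)) s" using d by (simp add: pt_def diff_eq_eq add.commute)
  moreover have "Y (ln (dist p0 p)) s = 0"
  proof (rule unique_continuation)
    show "Y (ln r) s = 0" for s using zero[of "pt (ln r) s"] r by (simp add: Y_def dist_pt)
    show "ln (dist p0 p) \<in> {ln r..ln R}" using p r d by auto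
    show "s \<in> {0..2 * pi}" using s by simp
  qed
  ultimately show ?thesis by (simp add: Y_def)
qed

text \<open>The interior of the zero set is relatively closed in \<open>D\<close>: a limit point
  \<open>q\<close> has an interior zero \<open>q'\<close> nearby, a small circle about
  \<open>q'\<close> consists of zeros, and the result for discs spreads them over a disc about
  \<open>q'\<close> that contains \<open>q\<close>.\<close>

lemma connected_unique_continuation:
  fixes X :: "real \<times> real \<Rightarrow> 'a::euclidean_space"
  assumes D: "open D" "connected D" and X: "C1_on D X"
    and J: "bounded_linear J" and J_skew: "\<And>x y. J x \<bullet> y = - (x \<bullet> J y)" and J_sq: "\<And>x. J (J x) = - x"
    and C: "continuous_on D C"
    and bound: "\<And>p. p \<in> D \<Longrightarrow> norm (pd_z X p + J (pd_rho X p)) \<le> C p * norm (X p)"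
    and U: "open U" "U \<noteq> {}" "U \<subseteq> D" "\<And>p. p \<in> U \<Longrightarrow> X p = 0"
    and p: "p \<in> D"
  shows "X p = 0"
proof -
  define Z where "Z = interior {p \<in> D. X p = 0}"
  have Z0: "X q = 0" "q \<in> D" if "q \<in> Z" for q
    using that interior_subset unfolding Z_def by auto
  have closed: "q \<in> Z" if q: "q \<in> D" "q \<in> closure Z" for q
  proof -
    obtain R' where R': "R' > 0" "ball q R' \<subseteq> D" using D q openE by blast
    \<comment> \<open>A disc of radius \<open>2 * R\<close> whose centre is closer than
      \<open>R\<close> to \<open>q\<close> contains \<open>q\<close> and stays within
      \<open>3 * R < R'\<close> of it.\<close>
    define R where "R = R' / 4"
    have R: "R > 0" using R' by (simp add: R_def)
    obtain q' where q': "q' \<in> Z" "dist q' q < R" using q R unfolding closure_approachable by blast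
    have sub: "cball q' (2 * R) \<subseteq> D"
    proof
      fix x assume "x \<in> cball q' (2 * R)"
      then have "dist q x < R'"
        using q'(2) R dist_triangle[of q x q'] by (simp add: R_def dist_commute)
      then show "x \<in> D" using R' by auto
    qed
    have "open Z" by (simp add: Z_def)
    then obtain r0 where r0: "r0 > 0" "ball q' r0 \<subseteq> Z" using q' openE by blast
    \<comment> \<open>Strictly below \<open>r0\<close>, so that the circle itself lies in
      \<open>Z\<close>, and at most the radius of the large disc.\<close>
    define r where "r = min (r0 / 2) (2 * R)"
    have r: "0 < r" "r \<le> 2 * R" "r < r0" using r0 R by (auto simp: r_def)
    have "continuous_on (cball q' (2 * R)) C" using continuous_on_subset[OF C sub] .
    then have "bounded (C ` cball q' (2 * R))"
      by (intro compact_imp_bounded compact_continuous_image compact_cball)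
    then obtain B where B: "B > 0" "\<And>x. x \<in> cball q' (2 * R) \<Longrightarrow> C x \<le> B"
      unfolding bounded_pos by (metis abs_le_D1 imageI real_norm_def)
    have zero: "X x = 0" if x: "dist q' x \<le> 2 * R" for x
    proof (cases "dist q' x < r0")
      case True
      then have "x \<in> Z" using r0 by auto
      then show ?thesis by (rule Z0)
    next
      case False
      show ?thesis
      proof (rule disc_unique_continuation[OF D(1) X sub r(1,2) J J_skew J_sq])
        show "norm (pd_z X y + J (pd_rho X y)) \<le> B * norm (X y)" if y: "y \<in> cball q' (2 * R)" for y
          using bound[of y] B(2)[OF y] y sub by (meson mult_right_mono norm_ge_zero order_trans subsetD)
        show "X y = 0" if "dist q' y = r" for y
        proof (rule Z0)
          show "y \<in> Z" using r0 r that by auto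
        qed
      qed (use B x False r in auto)
    qed
    have "ball q' (2 * R) \<subseteq> {p \<in> D. X p = 0}" using zero sub by (auto simp: subset_iff)
    then have "ball q' (2 * R) \<subseteq> Z" unfolding Z_def by (rule interior_maximal) simp
    then show "q \<in> Z" using q' R by auto
  qed
  have "U \<subseteq> Z" unfolding Z_def by (rule interior_maximal) (use U in auto)
  then have "Z \<inter> D \<noteq> {}" using U by blast
  moreover have "open Z" "open (- closure Z)" by (auto simp: Z_def)
  moreover have "D \<subseteq> Z \<union> - closure Z" using closed by blast
  moreover have "Z \<inter> - closure Z \<inter> D = {}" using closure_subset by blast
  ultimately have "- closure Z \<inter> D = {}" using D(2) unfolding connected_def by blast
  then have "p \<in> Z" using closed p by blast
  then show ?thesis by (rule Z0)
qed

text \<open>The unknown is the gradient. The first component of \<open>pd_z X + J (pd_rho X)\<close>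
  is the second-order operator applied to \<open>w\<close>; the second vanishes by the symmetry of
  mixed derivatives. The coefficients enter the estimate only through their norms, so they may be
  complex.\<close>

lemma gradient_unique_continuation:
  fixes w :: "real \<times> real \<Rightarrow> complex"
  assumes D: "open D" "connected D" and w: "C2_on D w"
    and ab: "continuous_on D a" "continuous_on D b"
    and pde: "\<And>p. p \<in> D \<Longrightarrow> pd_z (pd_z w) p + pd_rho (pd_rho w) p = a p * pd_z w p + b p * pd_rho w p"
    and U: "open U" "U \<noteq> {}" "U \<subseteq> D" "\<And>p. p \<in> U \<Longrightarrow> pd_z w p = 0 \<and> pd_rho w p = 0"
    and p: "p \<in> D"
  shows "pd_z w p = 0 \<and> pd_rho w p = 0"
proof -
  define X where "X q = (pd_z w q, pd_rho w q)" for q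
  define J :: "complex \<times> complex \<Rightarrow> complex \<times> complex" where "J x = (snd x, - fst x)" for x
  have C1: "C1_on D (pd_z w)" "C1_on D (pd_rho w)" using w by (auto simp: C2_on_def)
  have dX: "has_pd X q (pd_z (pd_z w) q, pd_z (pd_rho w) q) (pd_rho (pd_z w) q, pd_rho (pd_rho w) q)"
    if "q \<in> D" for q
    unfolding X_def
    using has_derivative_Pair[OF C1_on_has_pd[OF C1(1) D(1) that] C1_on_has_pd[OF C1(2) D(1) that]]
    by simp
  have "X p = 0"
  proof (rule connected_unique_continuation[OF D _ _ _ _ _ _ U(1,2,3) _ p])
    show "C1_on D X"
      by (rule C1_onI[OF D(1) dX]) (use C1 in \<open>auto simp: C1_on_def intro!: continuous_intros\<close>)
    show "bounded_linear J" unfolding J_def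
      by (intro bounded_linear_Pair bounded_linear_minus bounded_linear_fst bounded_linear_snd)
    show "J x \<bullet> y = - (x \<bullet> J y)" for x y by (simp add: J_def inner_prod_def)
    show "J (J x) = - x" for x by (cases x) (simp add: J_def)
    show "continuous_on D (\<lambda>q. norm (a q) + norm (b q))" by (intro continuous_intros ab)
    show "X q = 0" if "q \<in> U" for q using U(4)[OF that] by (simp add: X_def zero_prod_def)
    fix q assume q: "q \<in> D"
    have "pd_z X q + J (pd_rho X q) = (a q * pd_z w q + b q * pd_rho w q, 0)"
      using has_pd_imp[OF dX[OF q]] mixed_partials[OF D(1) w q] pde[OF q]
      by (simp add: J_def)
    then have "norm (pd_z X q + J (pd_rho X q)) \<le> norm (a q) * norm (pd_z w q) + norm (b q) * norm (pd_rho w q)"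
      using norm_triangle_ineq[of "a q * pd_z w q" "b q * pd_rho w q"] by (simp add: norm_mult)
    also have "\<dots> \<le> norm (a q) * norm (X q) + norm (b q) * norm (X q)"
      unfolding X_def by (intro add_mono mult_left_mono norm_fst_le norm_snd_le) auto
    finally show "norm (pd_z X q + J (pd_rho X q)) \<le> (norm (a q) + norm (b q)) * norm (X q)"
      by (simp add: distrib_right)
  qed
  then show ?thesis by (simp add: X_def zero_prod_def)
qed

section \<open>Electromagnetic fields with a common metric\<close>

text \<open>The hypotheses say that the vectors \<open>(x, y)\<close> and \<open>(x', y')\<close>
  have the same products of components with conjugated components, which determine a vector up to a
  phase. \<open>S\<close> is the squared length, \<open>k\<close> the Hermitian product of the two
  vectors, and the phase is \<open>k / S\<close>; multiplying by \<open>S\<close> includes the zero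
  vector.\<close>

lemma phase_of_gradient:
  fixes x y x' y' :: complex
  assumes "cmod x' = cmod x" "cmod y' = cmod y" "y' * cnj x' = y * cnj x"
  defines "S \<equiv> x * cnj x + y * cnj y" and "k \<equiv> x' * cnj x + y' * cnj y"
  shows "S * x' = k * x" "S * y' = k * y" "k * cnj k = S * S"
proof -
  have 1: "x' * cnj x' = x * cnj x" "y' * cnj y' = y * cnj y"
    using assms(1,2) by (simp_all add: complex_norm_square[symmetric])
  have 2: "x' * cnj y' = x * cnj y" using arg_cong[OF assms(3), of cnj] by (simp add: mult.commute)
  show *: "S * x' = k * x" "S * y' = k * y"
  proof -
    have "k * x = x' * (x * cnj x) + y' * (x * cnj y)" by (simp add: k_def algebra_simps)
    also have "\<dots> = x' * (x * cnj x) + y' * (x' * cnj y')" by (simp only: 2)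
    also have "\<dots> = x' * (x * cnj x) + x' * (y' * cnj y')" by (simp add: algebra_simps)
    also have "\<dots> = S * x'" by (simp add: S_def 1 algebra_simps)
    finally show "S * x' = k * x" ..
    have "k * y = x' * (y * cnj x) + y' * (y * cnj y)" by (simp add: k_def algebra_simps)
    also have "\<dots> = x' * (y' * cnj x') + y' * (y * cnj y)" by (simp only: assms(3))
    also have "\<dots> = y' * (x' * cnj x') + y' * (y * cnj y)" by (simp add: algebra_simps)
    also have "\<dots> = S * y'" by (simp add: S_def 1 algebra_simps)
    finally show "S * y' = k * y" ..
  qed
  have "k * cnj k = (k * x) * cnj x' + (k * y) * cnj y'" by (simp add: k_def algebra_simps)
  also have "\<dots> = S * (x' * cnj x' + y' * cnj y')" by (simp only: *[symmetric]) (simp add: algebra_simps)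
  also have "\<dots> = S * S" by (simp add: 1 S_def)
  finally show "k * cnj k = S * S" .
qed

text \<open>With \<open>k\<^sub>j = i \<alpha>\<^sub>j k\<close>, \<open>\<alpha>\<^sub>j\<close> real, the first two equations give \<open>(\<alpha>\<^sub>1\<^sup>2 + \<alpha>\<^sub>2\<^sup>2) x = (\<alpha>\<^sub>1\<^sup>2 + \<alpha>\<^sub>2\<^sup>2) y = 0\<close>.
  Reality of the \<open>\<alpha>\<^sub>j\<close> is what excludes null fields, for which \<open>x\<^sup>2 + y\<^sup>2 = 0\<close>, as an exception.\<close>

lemma phase_gradient_zero:
  fixes k k1 k2 x y :: complex
  assumes "k1 * x + k2 * y = 0" "k2 * x = k1 * y" "k * cnj k = 1"
    and "k * cnj k1 + k1 * cnj k = 0" "k * cnj k2 + k2 * cnj k = 0" "x \<noteq> 0 \<or> y \<noteq> 0"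
  shows "k1 = 0" "k2 = 0"
proof -
  let ?a = "k1 * cnj k" and ?b = "k2 * cnj k"
  have re: "Re ?a = 0" "Re ?b = 0"
    using assms(4,5) by (auto simp: complex_eq_iff algebra_simps)
  have "(k1 * k1 + k2 * k2) * x = k1 * (k1 * x + k2 * y) + k2 * (k2 * x - k1 * y)"
    "(k1 * k1 + k2 * k2) * y = k2 * (k1 * x + k2 * y) - k1 * (k2 * x - k1 * y)"
    by (simp_all add: algebra_simps)
  then have "k1 * k1 + k2 * k2 = 0" using assms(1,2,6) by auto
  then have "(cnj k * cnj k) * (k1 * k1 + k2 * k2) = 0" by simp
  then have "?a * ?a + ?b * ?b = 0" by (simp add: algebra_simps)
  moreover have "u = 0 \<and> v = 0" if "Re u = 0" "Re v = 0" "u * u + v * v = 0" for u v :: complex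
  proof -
    have "Re (u * u + v * v) = - ((Im u)\<^sup>2 + (Im v)\<^sup>2)" using that(1,2) by (simp add: power2_eq_square)
    then have "(Im u)\<^sup>2 + (Im v)\<^sup>2 = 0" unfolding that(3) by (simp only: zero_complex.sel)
    then show ?thesis using that(1,2) by (simp only: sum_power2_eq_zero_iff) (simp add: complex_eq_iff)
  qed
  ultimately have "?a = 0" "?b = 0" using re by blast+
  then show "k1 = 0" "k2 = 0" using assms(3) by auto
qed

lemma gradients_proportional:
  fixes \<Phi> \<Psi> :: "real \<times> real \<Rightarrow> complex"
  assumes D: "open D" "connected D" and C2: "C2_on D \<Phi>" "C2_on D \<Psi>"
    and ab: "continuous_on D a" "continuous_on D b"
    and pde\<Phi>: "\<And>p. p \<in> D \<Longrightarrow> pd_z (pd_z \<Phi>) p + pd_rho (pd_rho \<Phi>) p = a p * pd_z \<Phi> p + b p * pd_rho \<Phi> p"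
    and pde\<Psi>: "\<And>p. p \<in> D \<Longrightarrow> pd_z (pd_z \<Psi>) p + pd_rho (pd_rho \<Psi>) p = a p * pd_z \<Psi> p + b p * pd_rho \<Psi> p"
    and gram: "\<And>p. p \<in> D \<Longrightarrow> cmod (pd_z \<Psi> p) = cmod (pd_z \<Phi> p)"
      "\<And>p. p \<in> D \<Longrightarrow> cmod (pd_rho \<Psi> p) = cmod (pd_rho \<Phi> p)"
      "\<And>p. p \<in> D \<Longrightarrow> pd_rho \<Psi> p * cnj (pd_z \<Psi> p) = pd_rho \<Phi> p * cnj (pd_z \<Phi> p)"
  shows "\<exists>k. cmod k = 1 \<and> (\<forall>p\<in>D. pd_z \<Psi> p = k * pd_z \<Phi> p \<and> pd_rho \<Psi> p = k * pd_rho \<Phi> p)"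
proof (cases "\<forall>p\<in>D. pd_z \<Phi> p = 0 \<and> pd_rho \<Phi> p = 0")
  \<comment> \<open>A vanishing gradient admits every phase.\<close>
  case True
  then show ?thesis using gram(1,2) by (intro exI[of _ 1]) auto
next
  case False
  have C1: "C1_on D (pd_z \<Phi>)" "C1_on D (pd_rho \<Phi>)" "C1_on D (pd_z \<Psi>)" "C1_on D (pd_rho \<Psi>)"
    "C1_on D \<Phi>" "C1_on D \<Psi>"
    using C2 by (auto simp: C2_on_def)
  \<comment> \<open>The length and phase of \<open>phase_of_gradient\<close>, now as functions of
    the point. Where \<open>S\<close> does not vanish, \<open>k\<close> is differentiable because
    the second derivatives of both potentials exist.\<close>
  define S where "S p = pd_z \<Phi> p * cnj (pd_z \<Phi> p) + pd_rho \<Phi> p * cnj (pd_rho \<Phi> p)" for p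
  define k where "k p = (pd_z \<Psi> p * cnj (pd_z \<Phi> p) + pd_rho \<Psi> p * cnj (pd_rho \<Phi> p)) / S p" for p
  have S_real: "S p = of_real ((cmod (pd_z \<Phi> p))\<^sup>2 + (cmod (pd_rho \<Phi> p))\<^sup>2)" for p
    unfolding S_def of_real_add complex_norm_square ..
  have S0: "S p = 0 \<longleftrightarrow> pd_z \<Phi> p = 0 \<and> pd_rho \<Phi> p = 0" for p
    unfolding S_real by (simp only: of_real_eq_0_iff sum_power2_eq_zero_iff norm_eq_zero)
  obtain p0 where p0: "p0 \<in> D" "S p0 \<noteq> 0" using False S0 by blast
  have "continuous_on D S" unfolding S_def
    using C1 by (intro continuous_intros C1_on_continuous)
  then have "open (D \<inter> S -` (- {0}))"
    using D(1) by (intro continuous_open_preimage) auto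
  then obtain r where r: "r > 0" "ball p0 r \<subseteq> D \<inter> S -` (- {0})"
    using p0 openE[of "D \<inter> S -` (- {0})" p0] by auto
  define U where "U = ball p0 r"
  have U: "open U" "connected U" "p0 \<in> U" "U \<subseteq> D" "\<And>q. q \<in> U \<Longrightarrow> S q \<noteq> 0"
    using r by (auto simp: U_def simp del: mem_ball)
  have \<Psi>k: "pd_z \<Psi> q = k q * pd_z \<Phi> q" "pd_rho \<Psi> q = k q * pd_rho \<Phi> q" "k q * cnj (k q) = 1"
    if q: "q \<in> U" for q
  proof -
    have qD: "q \<in> D" and Sq: "S q \<noteq> 0" using q U by auto
    note ph = phase_of_gradient[OF gram(1)[OF qD] gram(2)[OF qD] gram(3)[OF qD], folded S_def]
    show "pd_z \<Psi> q = k q * pd_z \<Phi> q" "pd_rho \<Psi> q = k q * pd_rho \<Phi> q"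
      using ph(1,2) Sq by (simp_all add: k_def field_simps)
    have "cnj (S q) = S q" by (simp add: S_real)
    then show "k q * cnj (k q) = 1"
      unfolding k_def complex_cnj_divide times_divide_times_eq ph(3) using Sq by simp
  qed
  have dk: "has_pd k q 0 0" if q: "q \<in> U" for q
  proof -
    have qD: "q \<in> D" and Sq: "S q \<noteq> 0" using q U by auto
    have diff: "A differentiable (at q)" if "A \<in> {pd_z \<Phi>, pd_rho \<Phi>, pd_z \<Psi>, pd_rho \<Psi>}" for A
      using that C1_on_differentiable[OF _ D(1) qD] C1 by auto
    have diff': "(\<lambda>q. cnj (A q)) differentiable (at q)" if "A \<in> {pd_z \<Phi>, pd_rho \<Phi>, pd_z \<Psi>, pd_rho \<Psi>}" for A
      using has_pd_linear[OF bounded_linear_cnj differentiable_has_pd[OF diff[OF that]]] has_pd_imp(3) by blast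
    have "k differentiable (at q)"
    proof -
      have "(\<lambda>q. pd_z \<Psi> q * cnj (pd_z \<Phi> q) + pd_rho \<Psi> q * cnj (pd_rho \<Phi> q)) differentiable (at q)"
        "S differentiable (at q)"
        unfolding S_def by (intro derivative_intros differentiable_add differentiable_mult diff diff'; simp)+
      then show ?thesis using Sq unfolding k_def by (intro differentiable_divide)
    qed
    then have hk: "has_pd k q (pd_z k q) (pd_rho k q)" by (rule differentiable_has_pd)
    note h = C1_on_has_pd[OF C1(1) D(1) qD] C1_on_has_pd[OF C1(2) D(1) qD]
    have "has_pd (pd_z \<Psi>) q (k q * pd_z (pd_z \<Phi>) q + pd_z k q * pd_z \<Phi> q) (k q * pd_rho (pd_z \<Phi>) q + pd_rho k q * pd_z \<Phi> q)"
      by (rule has_pd_cong[OF has_pd_mult[OF hk h(1)] U(1) q]) (simp add: \<Psi>k)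
    note z = has_pd_imp(1,2)[OF this]
    have "has_pd (pd_rho \<Psi>) q (k q * pd_z (pd_rho \<Phi>) q + pd_z k q * pd_rho \<Phi> q) (k q * pd_rho (pd_rho \<Phi>) q + pd_rho k q * pd_rho \<Phi> q)"
      by (rule has_pd_cong[OF has_pd_mult[OF hk h(2)] U(1) q]) (simp add: \<Psi>k)
    note rho = has_pd_imp(1,2)[OF this]
    \<comment> \<open>The equation for \<Psi> with its gradient replaced by \<open>k\<close> times
      that of \<Phi>. Subtracting \<open>k\<close> times the equation for \<Phi> leaves only first
      derivatives of \<open>k\<close>.\<close>
    have "k q * (pd_z (pd_z \<Phi>) q + pd_rho (pd_rho \<Phi>) q) + (pd_z k q * pd_z \<Phi> q + pd_rho k q * pd_rho \<Phi> q)
        = k q * (a q * pd_z \<Phi> q + b q * pd_rho \<Phi> q)"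
      using pde\<Psi>[OF qD] by (simp add: z rho \<Psi>k[OF q] algebra_simps)
    then have 1: "pd_z k q * pd_z \<Phi> q + pd_rho k q * pd_rho \<Phi> q = 0"
      by (simp add: pde\<Phi>[OF qD])
    \<comment> \<open>Equality of the mixed derivatives of \<Psi>, after cancelling that of
      \<Phi>.\<close>
    have 2: "pd_rho k q * pd_z \<Phi> q = pd_z k q * pd_rho \<Phi> q"
      using mixed_partials[OF D(1) C2(1) qD] mixed_partials[OF D(1) C2(2) qD] by (simp add: z rho)
    have modulus: "has_pd (\<lambda>q. k q * cnj (k q)) q (k q * cnj (pd_z k q) + pd_z k q * cnj (k q))
        (k q * cnj (pd_rho k q) + pd_rho k q * cnj (k q))"
      by (rule has_pd_mult[OF hk has_pd_linear[OF bounded_linear_cnj hk]])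
    have "has_pd (\<lambda>q. k q * cnj (k q)) q 0 0"
    proof (rule has_pd_cong[OF _ U(1) q])
      show "has_pd (\<lambda>q. 1 :: complex) q 0 0" by simp
    qed (simp add: \<Psi>k)
    note 3 = has_pd_imp(1)[OF this, unfolded has_pd_imp(1)[OF modulus]]
      has_pd_imp(2)[OF this, unfolded has_pd_imp(2)[OF modulus]]
    have 4: "pd_z \<Phi> q \<noteq> 0 \<or> pd_rho \<Phi> q \<noteq> 0" using Sq S0 by blast
    show ?thesis using hk phase_gradient_zero[OF 1 2 \<Psi>k(3)[OF q] 3 4] by simp
  qed
  define k0 where "k0 = k p0"
  have k_const: "k q = k0" if "q \<in> U" for q
    unfolding k0_def using constant_if_pd_zero[OF U(1,2) dk that U(3)] .
  \<comment> \<open>As \<open>k0\<close> is constant, \<open>w\<close> solves the linear equation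
    shared by \<Phi> and \<Psi>, and its gradient vanishes on \<open>U\<close>. Zeros of the
    gradient of \<Phi> outside \<open>U\<close> do no harm to this difference.\<close>
  define w where "w q = \<Psi> q - k0 * \<Phi> q" for q
  have lin: "bounded_linear (\<lambda>x. k0 * x)" by (rule bounded_linear_mult_right)
  have w_pd: "has_pd w q (pd_z \<Psi> q - k0 * pd_z \<Phi> q) (pd_rho \<Psi> q - k0 * pd_rho \<Phi> q)" if "q \<in> D" for q
    unfolding w_def
    by (rule has_pd_diff[OF C1_on_has_pd[OF C1(6) D(1) that]
        has_pd_linear[OF lin C1_on_has_pd[OF C1(5) D(1) that]]])
  have w_z: "has_pd (pd_z w) q (pd_z (pd_z \<Psi>) q - k0 * pd_z (pd_z \<Phi>) q) (pd_rho (pd_z \<Psi>) q - k0 * pd_rho (pd_z \<Phi>) q)"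
    if "q \<in> D" for q
    by (rule has_pd_cong[OF has_pd_diff[OF C1_on_has_pd[OF C1(3) D(1) that]
        has_pd_linear[OF lin C1_on_has_pd[OF C1(1) D(1) that]]] D(1) that]) (simp add: has_pd_imp[OF w_pd])
  have w_rho: "has_pd (pd_rho w) q (pd_z (pd_rho \<Psi>) q - k0 * pd_z (pd_rho \<Phi>) q) (pd_rho (pd_rho \<Psi>) q - k0 * pd_rho (pd_rho \<Phi>) q)"
    if "q \<in> D" for q
    by (rule has_pd_cong[OF has_pd_diff[OF C1_on_has_pd[OF C1(4) D(1) that]
        has_pd_linear[OF lin C1_on_has_pd[OF C1(2) D(1) that]]] D(1) that]) (simp add: has_pd_imp[OF w_pd])
  have "pd_z w p = 0 \<and> pd_rho w p = 0" if p: "p \<in> D" for p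
  proof (rule gradient_unique_continuation[OF D _ ab _ U(1) _ U(4) _ p])
    show "C2_on D w" unfolding w_def by (intro C2_on_diff C2_on_linear[OF lin] C2 D)
    show "U \<noteq> {}" using U(3) by blast
    show "pd_z w q = 0 \<and> pd_rho w q = 0" if "q \<in> U" for q
      using has_pd_imp[OF w_pd, of q] \<Psi>k[OF that] k_const[OF that] U(4) that by auto
    show "pd_z (pd_z w) q + pd_rho (pd_rho w) q = a q * pd_z w q + b q * pd_rho w q" if q: "q \<in> D" for q
    proof -
      have "pd_z (pd_z w) q + pd_rho (pd_rho w) q = (pd_z (pd_z \<Psi>) q + pd_rho (pd_rho \<Psi>) q)
          - k0 * (pd_z (pd_z \<Phi>) q + pd_rho (pd_rho \<Phi>) q)"
        using has_pd_imp(1)[OF w_z[OF q]] has_pd_imp(2)[OF w_rho[OF q]] by (simp add: algebra_simps)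
      then show ?thesis
        unfolding has_pd_imp(1,2)[OF w_pd[OF q]] pde\<Phi>[OF q] pde\<Psi>[OF q] by (simp add: algebra_simps)
    qed
  qed
  then have "\<forall>p\<in>D. pd_z \<Psi> p = k0 * pd_z \<Phi> p \<and> pd_rho \<Psi> p = k0 * pd_rho \<Phi> p"
    using has_pd_imp(1,2)[OF w_pd] by simp
  moreover have "cmod k0 = 1"
  proof -
    have "complex_of_real ((cmod k0)\<^sup>2) = 1" using \<Psi>k(3)[OF U(3)] unfolding k0_def complex_norm_square .
    then have "(cmod k0)\<^sup>2 = 1" using of_real_eq_1_iff by blast
    then show ?thesis using norm_ge_zero[of k0] by (simp add: power2_eq_1_iff)
  qed
  ultimately show ?thesis by blast
qed

section \<open>The metric equations and the divergence and curl of G\<close>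

lemma ernst_f_has_pd:
  assumes "has_pd E p (pd_z E p) (pd_rho E p)" "has_pd \<Phi> p (pd_z \<Phi> p) (pd_rho \<Phi> p)"
  shows "has_pd (ernst_f E \<Phi>) p (Re (ernst_G_z E \<Phi> p)) (Re (ernst_G_rho E \<Phi> p))"
proof -
  have "ernst_f E \<Phi> = (\<lambda>q. Re (E q + \<Phi> q * cnj (\<Phi> q)))"
    unfolding fun_eq_iff ernst_f_def cmod_power2 by (simp add: power2_eq_square)
  moreover have "has_pd (\<lambda>q. Re (E q + \<Phi> q * cnj (\<Phi> q))) p
      (Re (pd_z E p + (\<Phi> p * cnj (pd_z \<Phi> p) + pd_z \<Phi> p * cnj (\<Phi> p))))
      (Re (pd_rho E p + (\<Phi> p * cnj (pd_rho \<Phi> p) + pd_rho \<Phi> p * cnj (\<Phi> p))))"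
    by (intro has_pd_linear[OF bounded_linear_Re] has_pd_add has_pd_mult
        has_pd_linear[OF bounded_linear_cnj] assms)
  ultimately show ?thesis by (simp add: ernst_G_z_def ernst_G_rho_def algebra_simps)
qed

lemma metric_fields_pd:
  assumes fields: "metric_fields D E \<Phi> f \<omega> \<gamma>" and D: "open D" and p: "p \<in> D" and E: "E differentiable (at p)"
  shows "f p = ernst_f E \<Phi> p"
    and "has_pd \<omega> p (- (snd p / (f p)\<^sup>2) * Im (ernst_G_rho E \<Phi> p)) (snd p / (f p)\<^sup>2 * Im (ernst_G_z E \<Phi> p))"
    and "has_pd \<gamma> p
      (snd p / (4 * (f p)\<^sup>2) * (2 * Re (ernst_G_rho E \<Phi> p * cnj (ernst_G_z E \<Phi> p)))
        - snd p / f p * (2 * Re (pd_rho \<Phi> p * cnj (pd_z \<Phi> p))))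
      (snd p / (4 * (f p)\<^sup>2) * ((cmod (ernst_G_rho E \<Phi> p))\<^sup>2 - (cmod (ernst_G_z E \<Phi> p))\<^sup>2)
        - snd p / f p * ((cmod (pd_rho \<Phi> p))\<^sup>2 - (cmod (pd_z \<Phi> p))\<^sup>2))"
proof -
  note F = fields[unfolded metric_fields_def]
  note Fp = F[THEN conjunct2, THEN conjunct2, rule_format, OF p]
  show "f p = ernst_f E \<Phi> p" using Fp by blast
  have diff: "\<omega> differentiable (at p)" "\<gamma> differentiable (at p)"
    using F p by (auto simp: differentiable_on_eq_differentiable_at[OF D])
  note Im_E = has_pd_imp(1,2)[OF has_pd_linear[OF bounded_linear_Im differentiable_has_pd[OF E]]]
  have "pd_z \<omega> p = - (snd p / (f p)\<^sup>2) * Im (ernst_G_rho E \<Phi> p)"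
    "pd_rho \<omega> p = snd p / (f p)\<^sup>2 * Im (ernst_G_z E \<Phi> p)"
    using Fp by (simp_all add: Im_E ernst_G_z_def ernst_G_rho_def mult.assoc)
  then show "has_pd \<omega> p (- (snd p / (f p)\<^sup>2) * Im (ernst_G_rho E \<Phi> p)) (snd p / (f p)\<^sup>2 * Im (ernst_G_z E \<Phi> p))"
    using differentiable_has_pd[OF diff(1)] by simp
  \<comment> \<open>The complex right-hand sides for \<gamma> are embedded real numbers;
    \<open>sym\<close> and \<open>sq\<close> exhibit them so that the embedding can be
    cancelled.\<close>
  have sym: "x * cnj y + y * cnj x = of_real (2 * Re (x * cnj y))" for x y
    by (simp add: complex_eq_iff)
  have sq: "x * cnj x - y * cnj y = of_real ((cmod x)\<^sup>2 - (cmod y)\<^sup>2)" for x y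
    by (simp only: of_real_diff complex_norm_square)
  have "pd_z \<gamma> p = snd p / (4 * (f p)\<^sup>2) * (2 * Re (ernst_G_rho E \<Phi> p * cnj (ernst_G_z E \<Phi> p)))
        - snd p / f p * (2 * Re (pd_rho \<Phi> p * cnj (pd_z \<Phi> p)))"
    using Fp unfolding sym of_real_mult[symmetric] of_real_diff[symmetric] of_real_eq_iff by blast
  moreover have "pd_rho \<gamma> p = snd p / (4 * (f p)\<^sup>2) * ((cmod (ernst_G_rho E \<Phi> p))\<^sup>2 - (cmod (ernst_G_z E \<Phi> p))\<^sup>2)
        - snd p / f p * ((cmod (pd_rho \<Phi> p))\<^sup>2 - (cmod (pd_z \<Phi> p))\<^sup>2)"
    using Fp unfolding sq of_real_mult[symmetric] of_real_diff[symmetric] of_real_eq_iff by blast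
  ultimately show "has_pd \<gamma> p
      (snd p / (4 * (f p)\<^sup>2) * (2 * Re (ernst_G_rho E \<Phi> p * cnj (ernst_G_z E \<Phi> p)))
        - snd p / f p * (2 * Re (pd_rho \<Phi> p * cnj (pd_z \<Phi> p))))
      (snd p / (4 * (f p)\<^sup>2) * ((cmod (ernst_G_rho E \<Phi> p))\<^sup>2 - (cmod (ernst_G_z E \<Phi> p))\<^sup>2)
        - snd p / f p * ((cmod (pd_rho \<Phi> p))\<^sup>2 - (cmod (pd_z \<Phi> p))\<^sup>2))"
    using differentiable_has_pd[OF diff(2)] by simp
qed

lemma ernst_G_has_pd:
  assumes D: "open D" and E: "C2_on D E" and \<Phi>: "C2_on D \<Phi>" and p: "p \<in> D"
  shows "has_pd (ernst_G_z E \<Phi>) p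
      (pd_z (pd_z E) p + (2 * cnj (\<Phi> p) * pd_z (pd_z \<Phi>) p + 2 * cnj (pd_z \<Phi> p) * pd_z \<Phi> p))
      (pd_rho (pd_z E) p + (2 * cnj (\<Phi> p) * pd_rho (pd_z \<Phi>) p + 2 * cnj (pd_rho \<Phi> p) * pd_z \<Phi> p))"
    and "has_pd (ernst_G_rho E \<Phi>) p
      (pd_z (pd_rho E) p + (2 * cnj (\<Phi> p) * pd_z (pd_rho \<Phi>) p + 2 * cnj (pd_z \<Phi> p) * pd_rho \<Phi> p))
      (pd_rho (pd_rho E) p + (2 * cnj (\<Phi> p) * pd_rho (pd_rho \<Phi>) p + 2 * cnj (pd_rho \<Phi> p) * pd_rho \<Phi> p))"
proof -
  have C1: "C1_on D \<Phi>" "C1_on D (pd_z E)" "C1_on D (pd_rho E)" "C1_on D (pd_z \<Phi>)" "C1_on D (pd_rho \<Phi>)"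
    using E \<Phi> by (auto simp: C2_on_def)
  have lin: "bounded_linear (\<lambda>x. 2 * cnj x)"
    by (rule bounded_linear_compose[OF bounded_linear_mult_right bounded_linear_cnj])
  note c = has_pd_linear[OF lin C1_on_has_pd[OF C1(1) D p]]
  show "has_pd (ernst_G_z E \<Phi>) p
      (pd_z (pd_z E) p + (2 * cnj (\<Phi> p) * pd_z (pd_z \<Phi>) p + 2 * cnj (pd_z \<Phi> p) * pd_z \<Phi> p))
      (pd_rho (pd_z E) p + (2 * cnj (\<Phi> p) * pd_rho (pd_z \<Phi>) p + 2 * cnj (pd_rho \<Phi> p) * pd_z \<Phi> p))"
    unfolding ernst_G_z_def
    by (rule has_pd_add[OF C1_on_has_pd[OF C1(2) D p] has_pd_mult[OF c C1_on_has_pd[OF C1(4) D p]]])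
  show "has_pd (ernst_G_rho E \<Phi>) p
      (pd_z (pd_rho E) p + (2 * cnj (\<Phi> p) * pd_z (pd_rho \<Phi>) p + 2 * cnj (pd_z \<Phi> p) * pd_rho \<Phi> p))
      (pd_rho (pd_rho E) p + (2 * cnj (\<Phi> p) * pd_rho (pd_rho \<Phi>) p + 2 * cnj (pd_rho \<Phi> p) * pd_rho \<Phi> p))"
    unfolding ernst_G_rho_def
    by (rule has_pd_add[OF C1_on_has_pd[OF C1(3) D p] has_pd_mult[OF c C1_on_has_pd[OF C1(5) D p]]])
qed

text \<open>Add \<open>2 * cnj (\<Phi> p)\<close> times the second Ernst equation to the first: the
  right sides combine to the square of G. The divergence contains in addition the terms where the
  factor \<open>cnj (\<Phi> p)\<close> is differentiated, and these are twice the squared gradient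
  of \<Phi>.\<close>

lemma ernst_G_divergence:
  assumes D: "open D" and sol: "ernst_solution D E \<Phi>" and p: "p \<in> D"
  shows "2 * of_real (ernst_f E \<Phi> p) * of_real ((cmod (pd_z \<Phi> p))\<^sup>2 + (cmod (pd_rho \<Phi> p))\<^sup>2) =
    of_real (ernst_f E \<Phi> p) * (pd_z (ernst_G_z E \<Phi>) p + pd_rho (ernst_G_rho E \<Phi>) p
      + ernst_G_rho E \<Phi> p / of_real (snd p)) - (ernst_G_z E \<Phi> p)\<^sup>2 - (ernst_G_rho E \<Phi> p)\<^sup>2"
proof -
  let ?F = "complex_of_real (ernst_f E \<Phi> p)"
  have C2: "C2_on D E" "C2_on D \<Phi>"
    and eqE: "?F * flat_laplacian E p = ernst_G_z E \<Phi> p * pd_z E p + ernst_G_rho E \<Phi> p * pd_rho E p"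
    and eq\<Phi>: "?F * flat_laplacian \<Phi> p = ernst_G_z E \<Phi> p * pd_z \<Phi> p + ernst_G_rho E \<Phi> p * pd_rho \<Phi> p"
    using sol p by (auto simp: ernst_solution_def)
  note G = ernst_G_has_pd[OF D C2 p]
  let ?N = "pd_z \<Phi> p * cnj (pd_z \<Phi> p) + pd_rho \<Phi> p * cnj (pd_rho \<Phi> p)"
  have "pd_z (ernst_G_z E \<Phi>) p + pd_rho (ernst_G_rho E \<Phi>) p + ernst_G_rho E \<Phi> p / of_real (snd p)
    = flat_laplacian E p + 2 * cnj (\<Phi> p) * flat_laplacian \<Phi> p + 2 * ?N"
    unfolding has_pd_imp(1)[OF G(1)] has_pd_imp(2)[OF G(2)]
    by (simp add: flat_laplacian_def ernst_G_rho_def add_divide_distrib algebra_simps)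
  then have "?F * (pd_z (ernst_G_z E \<Phi>) p + pd_rho (ernst_G_rho E \<Phi>) p + ernst_G_rho E \<Phi> p / of_real (snd p))
    = ?F * flat_laplacian E p + 2 * cnj (\<Phi> p) * (?F * flat_laplacian \<Phi> p) + 2 * ?F * ?N"
    by (simp only: distrib_left mult.assoc mult.left_commute[of ?F])
  also have "\<dots> = (ernst_G_z E \<Phi> p)\<^sup>2 + (ernst_G_rho E \<Phi> p)\<^sup>2 + 2 * ?F * ?N"
    unfolding eqE eq\<Phi> by (simp add: ernst_G_z_def ernst_G_rho_def power2_eq_square algebra_simps)
  finally show ?thesis unfolding of_real_add complex_norm_square by simp
qed

text \<open>A gradient has no curl, so only the derivative of the conjugated factor \<Phi>
  contributes. This supplies the imaginary part of a product of which the equations for \<gamma>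
  contain only the real part.\<close>

lemma ernst_G_curl:
  assumes D: "open D" and sol: "ernst_solution D E \<Phi>" and p: "p \<in> D"
  shows "Im (pd_z (ernst_G_rho E \<Phi>) p - pd_rho (ernst_G_z E \<Phi>) p) = 4 * Im (pd_rho \<Phi> p * cnj (pd_z \<Phi> p))"
proof -
  have C2: "C2_on D E" "C2_on D \<Phi>" using sol by (auto simp: ernst_solution_def)
  note G = ernst_G_has_pd[OF D C2 p]
  have "pd_z (ernst_G_rho E \<Phi>) p - pd_rho (ernst_G_z E \<Phi>) p
    = 2 * (pd_rho \<Phi> p * cnj (pd_z \<Phi> p) - pd_z \<Phi> p * cnj (pd_rho \<Phi> p))"
    unfolding has_pd_imp(2)[OF G(1)] has_pd_imp(1)[OF G(2)] mixed_partials[OF D C2(1) p] mixed_partials[OF D C2(2) p]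
    by (simp add: algebra_simps)
  then show ?thesis by simp
qed

text \<open>A constant phase of \<Phi> is a duality rotation, which mixes electric and magnetic
  fields. The last two hypotheses are what the equations for \<gamma> yield once f and G
  coincide.\<close>

lemma ernst_duality_rotation:
  assumes D: "open D" "connected D" "\<And>p. p \<in> D \<Longrightarrow> snd p > 0"
    and sol: "ernst_solution D E \<Phi>" and sol': "ernst_solution D E' \<Phi>'"
    and f_eq: "\<And>p. p \<in> D \<Longrightarrow> ernst_f E' \<Phi>' p = ernst_f E \<Phi> p"
    and Gz_eq: "\<And>p. p \<in> D \<Longrightarrow> ernst_G_z E' \<Phi>' p = ernst_G_z E \<Phi> p"
    and Grho_eq: "\<And>p. p \<in> D \<Longrightarrow> ernst_G_rho E' \<Phi>' p = ernst_G_rho E \<Phi> p"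
    and Re_eq: "\<And>p. p \<in> D \<Longrightarrow> Re (pd_rho \<Phi>' p * cnj (pd_z \<Phi>' p)) = Re (pd_rho \<Phi> p * cnj (pd_z \<Phi> p))"
    and diff_eq: "\<And>p. p \<in> D \<Longrightarrow> (cmod (pd_rho \<Phi>' p))\<^sup>2 - (cmod (pd_z \<Phi>' p))\<^sup>2 = (cmod (pd_rho \<Phi> p))\<^sup>2 - (cmod (pd_z \<Phi> p))\<^sup>2"
  shows "\<exists>k. cmod k = 1 \<and> (\<forall>p\<in>D. pd_z \<Phi>' p = k * pd_z \<Phi> p \<and> pd_rho \<Phi>' p = k * pd_rho \<Phi> p)"
proof -
  let ?f = "\<lambda>p. complex_of_real (ernst_f E \<Phi> p)"
  \<comment> \<open>Coefficients of the second Ernst equation after division by f, with the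
    first-order term of the Laplacian moved to the right side.\<close>
  define a where "a p = ernst_G_z E \<Phi> p / ?f p" for p
  define b where "b p = ernst_G_rho E \<Phi> p / ?f p - 1 / of_real (snd p)" for p
  have C2: "C2_on D E" "C2_on D \<Phi>" "C2_on D E'" "C2_on D \<Phi>'"
    and f0: "\<And>p. p \<in> D \<Longrightarrow> ?f p \<noteq> 0"
    using sol sol' by (auto simp: ernst_solution_def)
  have C1: "C1_on D E" "C1_on D \<Phi>" "C1_on D (pd_z E)" "C1_on D (pd_rho E)" "C1_on D (pd_z \<Phi>)" "C1_on D (pd_rho \<Phi>)"
    using C2 by (auto simp: C2_on_def)
  have cont: "continuous_on D a" "continuous_on D b"
  proof -
    have rho0: "\<forall>p\<in>D. complex_of_real (snd p) \<noteq> 0" using D(3) by fastforce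
    have G: "continuous_on D (ernst_G_z E \<Phi>)" "continuous_on D (ernst_G_rho E \<Phi>)"
      unfolding ernst_G_z_def ernst_G_rho_def by (intro continuous_intros C1[THEN C1_on_continuous])+
    have F: "continuous_on D ?f"
      unfolding ernst_f_def by (intro continuous_intros C1[THEN C1_on_continuous])
    show "continuous_on D a" unfolding a_def by (intro continuous_intros G F) (use f0 in blast)
    show "continuous_on D b" unfolding b_def by (intro continuous_intros G F) (use f0 rho0 in blast)+
  qed
  have pde: "pd_z (pd_z \<Psi>) p + pd_rho (pd_rho \<Psi>) p = a p * pd_z \<Psi> p + b p * pd_rho \<Psi> p"
    if "p \<in> D" "?f p * flat_laplacian \<Psi> p = ernst_G_z E \<Phi> p * pd_z \<Psi> p + ernst_G_rho E \<Phi> p * pd_rho \<Psi> p" for \<Psi> p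
  proof -
    have "flat_laplacian \<Psi> p = (ernst_G_z E \<Phi> p * pd_z \<Psi> p + ernst_G_rho E \<Phi> p * pd_rho \<Psi> p) / ?f p"
      using that f0 by (metis nonzero_mult_div_cancel_left)
    then show ?thesis
      by (simp add: flat_laplacian_def a_def b_def add_divide_distrib algebra_simps)
  qed
  have gram: "cmod (pd_z \<Phi>' p) = cmod (pd_z \<Phi> p) \<and> cmod (pd_rho \<Phi>' p) = cmod (pd_rho \<Phi> p) \<and>
      pd_rho \<Phi>' p * cnj (pd_z \<Phi>' p) = pd_rho \<Phi> p * cnj (pd_z \<Phi> p)" if p: "p \<in> D" for p
  proof -
    have dG: "pd_z (ernst_G_z E' \<Phi>') p = pd_z (ernst_G_z E \<Phi>) p"
      "pd_rho (ernst_G_z E' \<Phi>') p = pd_rho (ernst_G_z E \<Phi>) p"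
      "pd_z (ernst_G_rho E' \<Phi>') p = pd_z (ernst_G_rho E \<Phi>) p"
      "pd_rho (ernst_G_rho E' \<Phi>') p = pd_rho (ernst_G_rho E \<Phi>) p"
      using has_pd_cong[OF ernst_G_has_pd(1)[OF D(1) C2(3,4) p] D(1) p Gz_eq, THEN has_pd_imp(1)]
        has_pd_cong[OF ernst_G_has_pd(1)[OF D(1) C2(3,4) p] D(1) p Gz_eq, THEN has_pd_imp(2)]
        has_pd_cong[OF ernst_G_has_pd(2)[OF D(1) C2(3,4) p] D(1) p Grho_eq, THEN has_pd_imp(1)]
        has_pd_cong[OF ernst_G_has_pd(2)[OF D(1) C2(3,4) p] D(1) p Grho_eq, THEN has_pd_imp(2)]
        ernst_G_has_pd(1)[OF D(1) C2(3,4) p, THEN has_pd_imp(1)]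
        ernst_G_has_pd(1)[OF D(1) C2(3,4) p, THEN has_pd_imp(2)]
        ernst_G_has_pd(2)[OF D(1) C2(3,4) p, THEN has_pd_imp(1)]
        ernst_G_has_pd(2)[OF D(1) C2(3,4) p, THEN has_pd_imp(2)]
      by (simp_all only:)
    have "2 * ?f p * of_real ((cmod (pd_z \<Phi>' p))\<^sup>2 + (cmod (pd_rho \<Phi>' p))\<^sup>2)
        = 2 * ?f p * of_real ((cmod (pd_z \<Phi> p))\<^sup>2 + (cmod (pd_rho \<Phi> p))\<^sup>2)"
      using ernst_G_divergence[OF D(1) sol p] ernst_G_divergence[OF D(1) sol' p]
      by (simp only: f_eq[OF p] Gz_eq[OF p] Grho_eq[OF p] dG)
    then have "complex_of_real ((cmod (pd_z \<Phi>' p))\<^sup>2 + (cmod (pd_rho \<Phi>' p))\<^sup>2)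
        = of_real ((cmod (pd_z \<Phi> p))\<^sup>2 + (cmod (pd_rho \<Phi> p))\<^sup>2)"
      using f0[OF p] by (metis mult_cancel_left mult_eq_0_iff zero_neq_numeral)
    then have "(cmod (pd_z \<Phi>' p))\<^sup>2 + (cmod (pd_rho \<Phi>' p))\<^sup>2 = (cmod (pd_z \<Phi> p))\<^sup>2 + (cmod (pd_rho \<Phi> p))\<^sup>2"
      by (simp only: of_real_eq_iff)
    then have "(cmod (pd_z \<Phi>' p))\<^sup>2 = (cmod (pd_z \<Phi> p))\<^sup>2" "(cmod (pd_rho \<Phi>' p))\<^sup>2 = (cmod (pd_rho \<Phi> p))\<^sup>2"
      using diff_eq[OF p] by linarith+
    moreover have "Im (pd_rho \<Phi>' p * cnj (pd_z \<Phi>' p)) = Im (pd_rho \<Phi> p * cnj (pd_z \<Phi> p))"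
      using ernst_G_curl[OF D(1) sol p] ernst_G_curl[OF D(1) sol' p] by (simp only: dG)
    ultimately show ?thesis
      using Re_eq[OF p] by (auto intro: complex_eqI)
  qed
  show ?thesis
  proof (rule gradients_proportional[OF D(1,2) C2(2,4) cont])
    show "pd_z (pd_z \<Phi>) p + pd_rho (pd_rho \<Phi>) p = a p * pd_z \<Phi> p + b p * pd_rho \<Phi> p" if "p \<in> D" for p
      using pde[OF that] sol that by (auto simp: ernst_solution_def)
    show "pd_z (pd_z \<Phi>') p + pd_rho (pd_rho \<Phi>') p = a p * pd_z \<Phi>' p + b p * pd_rho \<Phi>' p" if "p \<in> D" for p
      using sol' that f_eq[OF that] Gz_eq[OF that] Grho_eq[OF that]
      by (intro pde[OF that]) (auto simp: ernst_solution_def)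
  qed (use gram in auto)
qed

text \<open>The derivatives of the shifted \<open>E\<close> are expressed by the unshifted G, which
  the gauge does not change; only the explicit factor \<open>gauge_Phi a \<Phi> p\<close> then has
  to be followed through a reflection.\<close>

lemma gauge_invariance:
  assumes E: "has_pd E p (pd_z E p) (pd_rho E p)" and \<Phi>: "has_pd \<Phi> p (pd_z \<Phi> p) (pd_rho \<Phi> p)"
  shows "has_pd (gauge_Phi a \<Phi>) p (pd_z \<Phi> p) (pd_rho \<Phi> p)"
    and "has_pd (gauge_E a b E \<Phi>) p (ernst_G_z E \<Phi> p - 2 * cnj (gauge_Phi a \<Phi> p) * pd_z \<Phi> p)
      (ernst_G_rho E \<Phi> p - 2 * cnj (gauge_Phi a \<Phi> p) * pd_rho \<Phi> p)"
proof -
  have const: "has_pd (\<lambda>q. c) p 0 0" for c :: complex by simp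
  show "has_pd (gauge_Phi a \<Phi>) p (pd_z \<Phi> p) (pd_rho \<Phi> p)"
    using has_pd_add[OF \<Phi> const] by (simp add: gauge_Phi_def[abs_def])
  have lin: "bounded_linear (\<lambda>x. 2 * cnj a * x)" by (rule bounded_linear_mult_right)
  have "has_pd (gauge_E a b E \<Phi>) p (pd_z E p - 2 * cnj a * pd_z \<Phi> p - 0 + 0) (pd_rho E p - 2 * cnj a * pd_rho \<Phi> p - 0 + 0)"
    unfolding gauge_E_def[abs_def]
    by (rule has_pd_add[OF has_pd_diff[OF has_pd_diff[OF E has_pd_linear[OF lin \<Phi>]] const] const])
  then show "has_pd (gauge_E a b E \<Phi>) p (ernst_G_z E \<Phi> p - 2 * cnj (gauge_Phi a \<Phi> p) * pd_z \<Phi> p)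
      (ernst_G_rho E \<Phi> p - 2 * cnj (gauge_Phi a \<Phi> p) * pd_rho \<Phi> p)"
    by (simp add: gauge_Phi_def ernst_G_z_def ernst_G_rho_def algebra_simps)
qed

lemma ernst_f_gauge: "ernst_f (gauge_E a b E \<Phi>) (gauge_Phi a \<Phi>) p = ernst_f E \<Phi> p"
proof -
  have "Re (gauge_E a b E \<Phi> p) = Re (E p) - 2 * (Re a * Re (\<Phi> p) + Im a * Im (\<Phi> p)) - (cmod a)\<^sup>2"
    unfolding gauge_E_def by (simp del: of_real_power)
  moreover have "(cmod (gauge_Phi a \<Phi> p))\<^sup>2 = (cmod (\<Phi> p))\<^sup>2 + 2 * (Re a * Re (\<Phi> p) + Im a * Im (\<Phi> p)) + (cmod a)\<^sup>2"
    unfolding gauge_Phi_def cmod_power2 plus_complex.sel power2_sum by (simp only: algebra_simps)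
  ultimately show ?thesis unfolding ernst_f_def by linarith
qed

section \<open>Reflections\<close>

lemma reflect_reflect [simp]: "reflect z0 (reflect z0 p) = p"
  by (simp add: reflect_def)

lemma snd_reflect [simp]: "snd (reflect z0 p) = snd p"
  by (simp add: reflect_def)

text \<open>The projection of \<open>D\<close> to the z-axis is an interval symmetric about
  \<open>z0\<close>, so it contains \<open>z0\<close>. At such a point a reflection law compares a
  field with itself, which fixes constants of integration.\<close>

lemma connected_reflect_fixed_point:
  assumes D: "connected D" "D \<noteq> {}" and R: "\<And>p. p \<in> D \<Longrightarrow> reflect z0 p \<in> D"
  obtains p0 where "p0 \<in> D" "reflect z0 p0 = p0"
proof -
  obtain p where p: "p \<in> D" using D by blast
  have "connected (fst ` D)" using D(1) by (intro connected_continuous_image continuous_intros)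
  then have I: "is_interval (fst ` D)" by (simp add: is_interval_connected_1)
  have "fst p \<in> fst ` D" "2 * z0 - fst p \<in> fst ` D"
    using p R[OF p] by (auto simp: reflect_def image_iff intro: bexI[of _ "reflect z0 p"])
  moreover have "fst p \<le> z0 \<and> z0 \<le> 2 * z0 - fst p \<or> 2 * z0 - fst p \<le> z0 \<and> z0 \<le> fst p" by linarith
  ultimately have "z0 \<in> fst ` D" using I unfolding is_interval_1 by blast
  then obtain p0 where "p0 \<in> D" "fst p0 = z0" by auto
  then show ?thesis using that by (simp add: reflect_def prod_eq_iff)
qed

text \<open>With \<sigma> applied at the reflected point, the law compares the mirror-image solution
  with the original: equal first potentials, and second potentials that differ by a duality
  rotation. Both parities have this form.\<close>

definition reflects :: "(real \<times> real) set \<Rightarrow> (complex \<Rightarrow> complex) \<Rightarrow> complex \<Rightarrow> real \<Rightarrow>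
    (real \<times> real \<Rightarrow> complex) \<Rightarrow> (real \<times> real \<Rightarrow> complex) \<Rightarrow> bool" where
  "reflects D \<sigma> \<kappa> z0 E \<Phi> \<longleftrightarrow> (\<forall>p\<in>D. reflect z0 p \<in> D \<and> \<sigma> (E (reflect z0 p)) = E p \<and> \<sigma> (\<Phi> (reflect z0 p)) = \<kappa> * \<Phi> p)"

lemma symmetric_potentials_iff:
  "symmetric_potentials D E \<Phi> \<longleftrightarrow> (\<exists>z0 \<kappa>. cmod \<kappa> = 1 \<and> reflects D cnj \<kappa> z0 E \<Phi>)"
proof
  assume "symmetric_potentials D E \<Phi>"
  then obtain z0 and \<delta> :: real where *: "\<forall>p\<in>D. reflect z0 p \<in> D \<and> E (reflect z0 p) = cnj (E p) \<and>
        \<Phi> (reflect z0 p) = exp (2 * \<i> * of_real \<delta>) * cnj (\<Phi> p)"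
    unfolding symmetric_potentials_def by blast
  have "reflects D cnj (cnj (exp (2 * \<i> * of_real \<delta>))) z0 E \<Phi>" using * by (simp add: reflects_def)
  moreover have "cmod (cnj (exp (2 * \<i> * of_real \<delta>))) = 1" by simp
  ultimately show "\<exists>z0 \<kappa>. cmod \<kappa> = 1 \<and> reflects D cnj \<kappa> z0 E \<Phi>" by blast
next
  assume "\<exists>z0 \<kappa>. cmod \<kappa> = 1 \<and> reflects D cnj \<kappa> z0 E \<Phi>"
  then obtain z0 \<kappa> where \<kappa>: "cmod \<kappa> = 1" and *: "reflects D cnj \<kappa> z0 E \<Phi>" by blast
  \<comment> \<open>Conjugating the law moves the phase to the other side, so \<kappa> has to be
    \<open>exp (- 2 * \<i> * of_real \<delta>)\<close>.\<close>
  define \<delta> where "\<delta> = - Arg \<kappa> / 2"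
  have "\<kappa> \<noteq> 0" using \<kappa> by auto
  then have "\<kappa> = cis (Arg \<kappa>)" using \<kappa> by (simp add: cis_Arg sgn_eq)
  then have "cnj \<kappa> = cis (2 * \<delta>)" unfolding \<delta>_def by (metis cis_cnj mult_minus_right nonzero_mult_div_cancel_left
        times_divide_eq_right zero_neq_numeral)
  then have \<delta>: "cnj \<kappa> = exp (2 * \<i> * of_real \<delta>)" by (simp add: cis_conv_exp mult_ac)
  have "reflect z0 p \<in> D \<and> E (reflect z0 p) = cnj (E p) \<and>
        \<Phi> (reflect z0 p) = exp (2 * \<i> * of_real \<delta>) * cnj (\<Phi> p)" if "p \<in> D" for p
    using * that unfolding reflects_def \<delta>[symmetric] by (metis complex_cnj_cnj complex_cnj_mult)
  then show "symmetric_potentials D E \<Phi>" unfolding symmetric_potentials_def by blast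
qed

text \<open>Applying the reflection twice shows \<open>\<kappa>\<^sup>2 = 1\<close> unless \<open>\<Phi> = 0\<close>.\<close>

lemma antisymmetric_potentials_iff:
  "antisymmetric_potentials D E \<Phi> \<longleftrightarrow> (\<exists>z0 \<kappa>. cmod \<kappa> = 1 \<and> reflects D (\<lambda>x. x) \<kappa> z0 E \<Phi>)"
proof
  assume "antisymmetric_potentials D E \<Phi>"
  then obtain z0 and s :: complex where "s \<in> {1, -1}" "\<forall>p\<in>D. reflect z0 p \<in> D \<and> E (reflect z0 p) = E p \<and>
        \<Phi> (reflect z0 p) = s * \<Phi> p"
    unfolding antisymmetric_potentials_def by blast
  then have "cmod s = 1 \<and> reflects D (\<lambda>x. x) s z0 E \<Phi>" by (auto simp: reflects_def)
  then show "\<exists>z0 \<kappa>. cmod \<kappa> = 1 \<and> reflects D (\<lambda>x. x) \<kappa> z0 E \<Phi>" by blast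
next
  assume "\<exists>z0 \<kappa>. cmod \<kappa> = 1 \<and> reflects D (\<lambda>x. x) \<kappa> z0 E \<Phi>"
  then obtain z0 \<kappa> where *: "\<And>p. p \<in> D \<Longrightarrow> reflect z0 p \<in> D"
      "\<And>p. p \<in> D \<Longrightarrow> E (reflect z0 p) = E p" "\<And>p. p \<in> D \<Longrightarrow> \<Phi> (reflect z0 p) = \<kappa> * \<Phi> p"
    unfolding reflects_def by blast
  have "\<exists>s\<in>{1, -1}. \<forall>p\<in>D. \<kappa> * \<Phi> p = s * \<Phi> p"
  proof (cases "\<forall>p\<in>D. \<Phi> p = 0")
    case False
    then obtain p where p: "p \<in> D" "\<Phi> p \<noteq> 0" by blast
    have "\<Phi> p = \<kappa> * (\<kappa> * \<Phi> p)" using *(3)[OF *(1)[OF p(1)]] *(3)[OF p(1)] by simp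
    then have "\<kappa> * \<kappa> = 1" using p(2) by (simp add: mult.assoc[symmetric])
    then have "\<kappa> \<in> {1, -1}" by (auto simp: square_eq_1_iff)
    then show ?thesis by blast
  qed auto
  then obtain s where s: "s \<in> {1, -1}" "\<forall>p\<in>D. \<kappa> * \<Phi> p = s * \<Phi> p" by blast
  have "\<forall>p\<in>D. reflect z0 p \<in> D \<and> E (reflect z0 p) = E p \<and> \<Phi> (reflect z0 p) = s * \<Phi> p"
    using * s(2) by simp
  then show "antisymmetric_potentials D E \<Phi>" unfolding antisymmetric_potentials_def using s(1) by blast
qed

lemma reflect_at_infinity:
  assumes "\<And>p. p \<in> D \<Longrightarrow> reflect z0 p \<in> D"
  shows "filterlim (reflect z0) (inf at_infinity (principal D)) (inf at_infinity (principal D))"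
  unfolding filterlim_inf
proof
  show "filterlim (reflect z0) (principal D) (inf at_infinity (principal D))"
    unfolding filterlim_principal eventually_inf_principal using assms by simp
  have "filterlim (reflect z0) at_infinity at_infinity"
    unfolding filterlim_at_infinity[OF order_refl]
  proof (intro allI impI)
    fix r :: real assume "r > 0"
    have "r \<le> norm (reflect z0 p)" if "r + \<bar>2 * z0\<bar> \<le> norm p" for p
    proof -
      have "norm (reflect z0 p) = norm (p - (2 * z0, 0))"
        by (cases p) (simp add: reflect_def norm_Pair power2_commute)
      moreover have "norm p - norm ((2 * z0, 0) :: real \<times> real) \<le> norm (p - (2 * z0, 0))"
        by (rule norm_triangle_ineq2)
      moreover have "norm ((2 * z0, 0) :: real \<times> real) \<le> \<bar>2 * z0\<bar>"
        using norm_Pair_le[of "2 * z0" "0 :: real"] by simp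
      ultimately show ?thesis using that by linarith
    qed
    then show "\<forall>\<^sub>F p in at_infinity. r \<le> norm (reflect z0 p)"
      unfolding eventually_at_infinity by blast
  qed
  then show "filterlim (reflect z0) at_infinity (inf at_infinity (principal D))"
    by (rule filterlim_mono) auto
qed

text \<open>\<open>s\<close> is the parity of \<omega>, while \<sigma> multiplies imaginary parts by
  \<open>- s\<close>. The signs are opposite because the gradient of \<omega> is the imaginary part
  of G turned by a right angle, and the reflection reverses the sense of that turn.\<close>

locale ernst_reflection =
  fixes D :: "(real \<times> real) set" and E \<Phi> :: "real \<times> real \<Rightarrow> complex" and f \<omega> \<gamma> :: "real \<times> real \<Rightarrow> real"
    and \<sigma> :: "complex \<Rightarrow> complex" and s :: real and z0 :: real
  assumes D_open: "open D" and D_connected: "connected D" and D_pos: "p \<in> D \<Longrightarrow> snd p > 0"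
    and solution: "ernst_solution D E \<Phi>"
    and fields: "metric_fields D E \<Phi> f \<omega> \<gamma>"
    and parity: "(\<sigma> = cnj \<and> s = 1) \<or> (\<sigma> = (\<lambda>x. x) \<and> s = -1)"
begin

abbreviation R where "R \<equiv> reflect z0"

text \<open>\<open>k\<close> leaves room for the integration constant of \<omega>: in the odd case
  it is twice the constant about which \<omega> is odd, in the even case a point of the mirror line
  forces it to be 0.\<close>

definition reflects_metric :: "real \<Rightarrow> bool" where
  "reflects_metric k \<longleftrightarrow> (\<forall>p\<in>D. R p \<in> D \<and> f (R p) = f p \<and> \<gamma> (R p) = \<gamma> p \<and> \<omega> (R p) = s * \<omega> p + k)"

lemma sigma_simps [simp]:
  "\<sigma> (x + y) = \<sigma> x + \<sigma> y" "\<sigma> (x - y) = \<sigma> x - \<sigma> y" "\<sigma> (x * y) = \<sigma> x * \<sigma> y" "\<sigma> (- x) = - \<sigma> x" "\<sigma> (x / y) = \<sigma> x / \<sigma> y"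
  "\<sigma> (of_real r) = of_real r" "\<sigma> 0 = 0" "\<sigma> (numeral n) = numeral n" "\<sigma> (\<sigma> x) = x"
  "cmod (\<sigma> x) = cmod x" "Re (\<sigma> x) = Re x" "Im (\<sigma> x) = - s * Im x"
  using parity by auto

lemma sigma_cnj: "\<sigma> (cnj x) = cnj (\<sigma> x)"
  using parity by auto

lemma s_square [simp]: "s * (s * x) = x"
  using parity by auto

lemma sigma_linear: "bounded_linear \<sigma>"
  using parity bounded_linear_cnj bounded_linear_ident by auto

lemma C2: "C2_on D E" "C2_on D \<Phi>" and f_nonzero: "p \<in> D \<Longrightarrow> ernst_f E \<Phi> p \<noteq> 0"
  using solution by (auto simp: ernst_solution_def)

lemma C1: "C1_on D E" "C1_on D \<Phi>"
  using C2 by (auto simp: C2_on_def)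

lemma potential_pd:
  assumes "p \<in> D"
  shows "has_pd E p (pd_z E p) (pd_rho E p)" "has_pd \<Phi> p (pd_z \<Phi> p) (pd_rho \<Phi> p)"
  using C1_on_has_pd[OF C1(1) D_open assms] C1_on_has_pd[OF C1(2) D_open assms] by auto

lemmas metric_pd = metric_fields_pd[OF fields D_open _ C1_on_differentiable[OF C1(1) D_open]]

lemma f_pd:
  assumes "p \<in> D"
  shows "has_pd f p (Re (ernst_G_z E \<Phi> p)) (Re (ernst_G_rho E \<Phi> p))"
  by (rule has_pd_cong[OF ernst_f_has_pd[OF potential_pd[OF assms]] D_open assms])
    (simp add: metric_pd(1))

section \<open>The mirror image of a solution\<close>

lemma reflected_pd:
  assumes "has_pd A (R p) a b"
  shows "has_pd (\<lambda>q. \<sigma> (A (R q))) p (- \<sigma> a) (\<sigma> b)"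
  using has_pd_linear[OF sigma_linear has_pd_reflect[OF assms]] by simp

context
  assumes R_ball: "\<forall>p\<in>D. R p \<in> D"
begin

lemmas R_D = bspec[OF R_ball]

lemma reflected_C2: "C2_on D A \<Longrightarrow> C2_on D (\<lambda>q. \<sigma> (A (R q)))"
  by (intro C2_on_linear[OF sigma_linear D_open] C2_on_reflect[OF D_open R_D])

lemma reflected_laplacian:
  assumes A: "C2_on D A" and p: "p \<in> D"
  shows "pd_z (\<lambda>q. \<sigma> (A (R q))) p = - \<sigma> (pd_z A (R p))"
    "pd_rho (\<lambda>q. \<sigma> (A (R q))) p = \<sigma> (pd_rho A (R p))"
    "flat_laplacian (\<lambda>q. \<sigma> (A (R q))) p = \<sigma> (flat_laplacian A (R p))"
proof -
  have C1: "C1_on D A" "C1_on D (pd_z A)" "C1_on D (pd_rho A)" using A by (auto simp: C2_on_def)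
  note first = has_pd_imp(1,2)[OF reflected_pd[OF C1_on_has_pd[OF C1(1) D_open R_D]]]
  show pd: "pd_z (\<lambda>q. \<sigma> (A (R q))) p = - \<sigma> (pd_z A (R p))"
    "pd_rho (\<lambda>q. \<sigma> (A (R q))) p = \<sigma> (pd_rho A (R p))"
    using first p by auto
  have "has_pd (\<lambda>q. - \<sigma> (pd_z A (R q))) p (- (- \<sigma> (pd_z (pd_z A) (R p)))) (- \<sigma> (pd_rho (pd_z A) (R p)))"
    by (rule has_pd_linear[OF bounded_linear_minus[OF bounded_linear_ident]
        reflected_pd[OF C1_on_has_pd[OF C1(2) D_open R_D[OF p]]]])
  from has_pd_cong[OF this D_open p first(1)[symmetric]]
  have zz: "pd_z (pd_z (\<lambda>q. \<sigma> (A (R q)))) p = \<sigma> (pd_z (pd_z A) (R p))"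
    using has_pd_imp(1) by fastforce
  from has_pd_cong[OF reflected_pd[OF C1_on_has_pd[OF C1(3) D_open R_D[OF p]]] D_open p first(2)[symmetric]]
  have "pd_rho (pd_rho (\<lambda>q. \<sigma> (A (R q)))) p = \<sigma> (pd_rho (pd_rho A) (R p))"
    using has_pd_imp(2) by fastforce
  then show "flat_laplacian (\<lambda>q. \<sigma> (A (R q))) p = \<sigma> (flat_laplacian A (R p))"
    by (simp add: flat_laplacian_def zz pd)
qed

text \<open>Either \<sigma> is a field automorphism that fixes the reals and commutes with
  conjugation, and z-derivatives occur in the Ernst equations only in pairs, so the signs produced
  by the reflection cancel.\<close>

lemma reflected_solution:
  shows "\<And>p. p \<in> D \<Longrightarrow> ernst_f (\<lambda>q. \<sigma> (E (R q))) (\<lambda>q. \<sigma> (\<Phi> (R q))) p = ernst_f E \<Phi> (R p)"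
    and "\<And>p. p \<in> D \<Longrightarrow> ernst_G_z (\<lambda>q. \<sigma> (E (R q))) (\<lambda>q. \<sigma> (\<Phi> (R q))) p = - \<sigma> (ernst_G_z E \<Phi> (R p))"
    and "\<And>p. p \<in> D \<Longrightarrow> ernst_G_rho (\<lambda>q. \<sigma> (E (R q))) (\<lambda>q. \<sigma> (\<Phi> (R q))) p = \<sigma> (ernst_G_rho E \<Phi> (R p))"
    and "ernst_solution D (\<lambda>q. \<sigma> (E (R q))) (\<lambda>q. \<sigma> (\<Phi> (R q)))"
proof -
  note E = reflected_laplacian[OF C2(1)] and \<Phi> = reflected_laplacian[OF C2(2)]
  show f: "ernst_f (\<lambda>q. \<sigma> (E (R q))) (\<lambda>q. \<sigma> (\<Phi> (R q))) p = ernst_f E \<Phi> (R p)" for p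
    by (simp add: ernst_f_def)
  show Gz: "ernst_G_z (\<lambda>q. \<sigma> (E (R q))) (\<lambda>q. \<sigma> (\<Phi> (R q))) p = - \<sigma> (ernst_G_z E \<Phi> (R p))" if "p \<in> D" for p
    using that by (simp add: ernst_G_z_def E \<Phi> sigma_cnj)
  show Grho: "ernst_G_rho (\<lambda>q. \<sigma> (E (R q))) (\<lambda>q. \<sigma> (\<Phi> (R q))) p = \<sigma> (ernst_G_rho E \<Phi> (R p))" if "p \<in> D" for p
    using that by (simp add: ernst_G_rho_def E \<Phi> sigma_cnj)
  have eq: "of_real (ernst_f E \<Phi> (R p)) * \<sigma> (flat_laplacian A (R p))
      = - \<sigma> (ernst_G_z E \<Phi> (R p)) * - \<sigma> (pd_z A (R p)) + \<sigma> (ernst_G_rho E \<Phi> (R p)) * \<sigma> (pd_rho A (R p))"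
    if "p \<in> D" and A: "A = E \<or> A = \<Phi>" for A p
  proof -
    have "of_real (ernst_f E \<Phi> (R p)) * flat_laplacian A (R p)
      = ernst_G_z E \<Phi> (R p) * pd_z A (R p) + ernst_G_rho E \<Phi> (R p) * pd_rho A (R p)"
      using solution R_D[OF that(1)] A by (auto simp: ernst_solution_def)
    from arg_cong[OF this, of \<sigma>] show ?thesis by simp
  qed
  show "ernst_solution D (\<lambda>q. \<sigma> (E (R q))) (\<lambda>q. \<sigma> (\<Phi> (R q)))"
    unfolding ernst_solution_def
    by (intro conjI ballI reflected_C2 C2) (simp_all add: f Gz Grho E \<Phi> eq R_D f_nonzero del: minus_mult_minus)
qed

end

lemma reflects_metric_imp_potentials:
  assumes refl: "reflects_metric k"
  shows "\<exists>a b \<kappa>. cmod \<kappa> = 1 \<and> reflects D \<sigma> \<kappa> z0 (gauge_E a b E \<Phi>) (gauge_Phi a \<Phi>)"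
proof (cases "D = {}")
  case True
  then show ?thesis by (intro exI[of _ 0] exI[of _ 1]) (simp add: reflects_def)
next
  case False
  have R_D: "R p \<in> D" and even: "f (R p) = f p" "\<gamma> (R p) = \<gamma> p" "\<omega> (R p) = s * \<omega> p + k" if "p \<in> D" for p
    using refl that by (auto simp: reflects_metric_def)
  let ?E = "\<lambda>q. \<sigma> (E (R q))" and ?\<Phi> = "\<lambda>q. \<sigma> (\<Phi> (R q))"
  have R_ball: "\<forall>p\<in>D. R p \<in> D" using R_D by blast
  note refl_sol = reflected_solution[OF R_ball]
  have rho_f: "snd p / (f p)\<^sup>2 \<noteq> 0" "snd p / (4 * (f p)\<^sup>2) \<noteq> 0" "snd p / f p \<noteq> 0" if "p \<in> D" for p
    using D_pos[OF that] f_nonzero[OF that] metric_pd(1)[OF that that] by auto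
  \<comment> \<open>Differentiating the law for \<open>f\<close> gives the real parts,
    differentiating the law for \<omega> the imaginary parts.\<close>
  have G: "ernst_G_z E \<Phi> (R p) = - \<sigma> (ernst_G_z E \<Phi> p)" "ernst_G_rho E \<Phi> (R p) = \<sigma> (ernst_G_rho E \<Phi> p)"
    if p: "p \<in> D" for p
  proof -
    have "has_pd f p (- Re (ernst_G_z E \<Phi> (R p))) (Re (ernst_G_rho E \<Phi> (R p)))"
      by (rule has_pd_cong[OF has_pd_reflect[OF f_pd[OF R_D[OF p]]] D_open p]) (rule even)
    note f1 = has_pd_imp(1,2)[OF this, unfolded has_pd_imp(1,2)[OF f_pd[OF p]]]
    have lin: "bounded_linear (\<lambda>x. s * x)" by (rule bounded_linear_mult_right)
    have const: "has_pd (\<lambda>q. k) p 0 0" by simp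
    have "has_pd (\<lambda>q. s * \<omega> q + k) p (- (- (snd p / (f p)\<^sup>2) * Im (ernst_G_rho E \<Phi> (R p)))) (snd p / (f p)\<^sup>2 * Im (ernst_G_z E \<Phi> (R p)))"
      by (rule has_pd_cong[OF has_pd_reflect[OF metric_pd(2)[OF R_D[OF p] R_D[OF p], unfolded even(1)[OF p] snd_reflect]] D_open p])
        (rule even)
    note w1 = has_pd_imp(1,2)[OF this, unfolded has_pd_imp(1,2)[OF has_pd_add[OF has_pd_linear[OF lin metric_pd(2)[OF p p]] const]]]
    have cancel: "s * (- c * x) + 0 = - (- c * y) \<Longrightarrow> c * y = c * (- s * x)" for c x y :: real
      by (simp add: algebra_simps)
    have cancel': "s * (c * x) + 0 = c * y \<Longrightarrow> c * y = c * (s * x)" for c x y :: real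
      by (metis add.right_neutral mult.left_commute)
    have "snd p / (f p)\<^sup>2 * Im (ernst_G_rho E \<Phi> (R p)) = snd p / (f p)\<^sup>2 * (- s * Im (ernst_G_rho E \<Phi> p))"
      "snd p / (f p)\<^sup>2 * Im (ernst_G_z E \<Phi> (R p)) = snd p / (f p)\<^sup>2 * (s * Im (ernst_G_z E \<Phi> p))"
      by (rule cancel[OF w1(1)], rule cancel'[OF w1(2)])
    then have "Im (ernst_G_rho E \<Phi> (R p)) = - s * Im (ernst_G_rho E \<Phi> p)" "Im (ernst_G_z E \<Phi> (R p)) = s * Im (ernst_G_z E \<Phi> p)"
      using rho_f(1)[OF p] by (metis mult_left_cancel)+
    then show "ernst_G_z E \<Phi> (R p) = - \<sigma> (ernst_G_z E \<Phi> p)" "ernst_G_rho E \<Phi> (R p) = \<sigma> (ernst_G_rho E \<Phi> p)"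
      using f1 by (simp_all add: complex_eq_iff)
  qed
  have G': "ernst_G_z ?E ?\<Phi> p = ernst_G_z E \<Phi> p" "ernst_G_rho ?E ?\<Phi> p = ernst_G_rho E \<Phi> p" if "p \<in> D" for p
    using refl_sol(2,3)[OF that] G[OF that] by simp_all
  note \<Phi>' = reflected_laplacian(1,2)[OF R_ball C2(2)]
  have gram: "Re (pd_rho ?\<Phi> p * cnj (pd_z ?\<Phi> p)) = Re (pd_rho \<Phi> p * cnj (pd_z \<Phi> p))"
    "(cmod (pd_rho ?\<Phi> p))\<^sup>2 - (cmod (pd_z ?\<Phi> p))\<^sup>2 = (cmod (pd_rho \<Phi> p))\<^sup>2 - (cmod (pd_z \<Phi> p))\<^sup>2"
    if p: "p \<in> D" for p
  proof -
    let ?c = "snd p / (4 * (f p)\<^sup>2)" and ?d = "snd p / f p"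
    note \<gamma>p = metric_pd(3)[OF p p]
    note \<gamma>R = metric_pd(3)[OF R_D[OF p] R_D[OF p], unfolded even(1)[OF p] snd_reflect]
    \<comment> \<open>The G term in the z-derivative of \<gamma> is odd under the reflection, like
      the left side of that equation; so the \<Phi> term is odd as well and can be isolated.\<close>
    have Re_G: "Re (ernst_G_rho E \<Phi> (R p) * cnj (ernst_G_z E \<Phi> (R p))) = - Re (ernst_G_rho E \<Phi> p * cnj (ernst_G_z E \<Phi> p))"
      unfolding G[OF p] complex_cnj_minus sigma_cnj[symmetric] mult_minus_right sigma_simps(3)[symmetric] by simp
    have Re_\<Phi>: "Re (pd_rho ?\<Phi> p * cnj (pd_z ?\<Phi> p)) = - Re (pd_rho \<Phi> (R p) * cnj (pd_z \<Phi> (R p)))"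
      unfolding \<Phi>'[OF p] complex_cnj_minus sigma_cnj[symmetric] mult_minus_right sigma_simps(3)[symmetric] by simp
    have norm_\<Phi>: "cmod (pd_rho ?\<Phi> p) = cmod (pd_rho \<Phi> (R p))" "cmod (pd_z ?\<Phi> p) = cmod (pd_z \<Phi> (R p))"
      by (simp_all add: \<Phi>'[OF p])
    have norm_G: "cmod (ernst_G_rho E \<Phi> (R p)) = cmod (ernst_G_rho E \<Phi> p)" "cmod (ernst_G_z E \<Phi> (R p)) = cmod (ernst_G_z E \<Phi> p)"
      by (simp_all add: G[OF p])
    have "\<And>q. q \<in> D \<Longrightarrow> \<gamma> (R q) = \<gamma> q" by (rule even)
    note \<gamma>1 = has_pd_imp(1,2)[OF has_pd_cong[OF has_pd_reflect[OF \<gamma>R] D_open p this]]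
    have cancel: "c * (2 * x) - d * (2 * y) = - (c * (2 * - x) - d * (2 * z)) \<Longrightarrow> d * - z = d * y" for c d x y z :: real
      by simp
    have "?d * Re (pd_rho ?\<Phi> p * cnj (pd_z ?\<Phi> p)) = ?d * Re (pd_rho \<Phi> p * cnj (pd_z \<Phi> p))"
      unfolding Re_\<Phi> by (rule cancel[OF \<gamma>1(1)[unfolded has_pd_imp(1)[OF \<gamma>p] Re_G]])
    then show "Re (pd_rho ?\<Phi> p * cnj (pd_z ?\<Phi> p)) = Re (pd_rho \<Phi> p * cnj (pd_z \<Phi> p))"
      using rho_f(3)[OF p] mult_left_cancel by blast
    have "?d * ((cmod (pd_rho ?\<Phi> p))\<^sup>2 - (cmod (pd_z ?\<Phi> p))\<^sup>2) = ?d * ((cmod (pd_rho \<Phi> p))\<^sup>2 - (cmod (pd_z \<Phi> p))\<^sup>2)"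
      using \<gamma>1(2)[unfolded has_pd_imp(2)[OF \<gamma>p] norm_G] unfolding norm_\<Phi> by linarith
    then show "(cmod (pd_rho ?\<Phi> p))\<^sup>2 - (cmod (pd_z ?\<Phi> p))\<^sup>2 = (cmod (pd_rho \<Phi> p))\<^sup>2 - (cmod (pd_z \<Phi> p))\<^sup>2"
      using rho_f(3)[OF p] mult_left_cancel by blast
  qed
  have f': "ernst_f ?E ?\<Phi> p = ernst_f E \<Phi> p" if "p \<in> D" for p
    using refl_sol(1)[OF that] even(1)[OF that] metric_pd(1)[OF that that] metric_pd(1)[OF R_D[OF that] R_D[OF that]]
    by simp
  obtain \<kappa> where \<kappa>: "cmod \<kappa> = 1" "\<And>p. p \<in> D \<Longrightarrow> pd_z ?\<Phi> p = \<kappa> * pd_z \<Phi> p"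
      "\<And>p. p \<in> D \<Longrightarrow> pd_rho ?\<Phi> p = \<kappa> * pd_rho \<Phi> p"
    using ernst_duality_rotation[OF D_open D_connected D_pos solution refl_sol(4) f' G' gram] by blast
  have cnj_\<kappa>: "cnj \<kappa> * \<kappa> = 1" using complex_norm_square[of \<kappa>] \<kappa>(1) by (simp add: mult.commute)
  obtain p0 where p0: "p0 \<in> D" "R p0 = p0"
    using connected_reflect_fixed_point[OF D_connected False R_D] by blast
  \<comment> \<open>In this gauge the second potential vanishes and the first is real at the mirror
    point, so both laws hold there for every \<kappa>. \<open>b\<close> is read off at shift 0
    because it is simply added to the imaginary part.\<close>
  define a where "a = - \<Phi> p0"
  define b where "b = - Im (gauge_E a 0 E \<Phi> p0)"
  let ?E1 = "gauge_E a b E \<Phi>" and ?\<Phi>1 = "gauge_Phi a \<Phi>"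
  have \<Phi>1_0: "?\<Phi>1 p0 = 0" by (simp add: gauge_Phi_def a_def)
  have "Im (?E1 p0) = 0" by (simp add: b_def gauge_E_def)
  then have E1_0: "\<sigma> (?E1 p0) = ?E1 p0" by (simp add: complex_eq_iff)
  note gauge_pd = gauge_invariance[OF potential_pd]
  have refl\<Phi>: "\<sigma> (?\<Phi>1 (R p)) = \<kappa> * ?\<Phi>1 p" if p: "p \<in> D" for p
  proof -
    have lin: "bounded_linear (\<lambda>x. \<kappa> * x)" by (rule bounded_linear_mult_right)
    have "has_pd (\<lambda>q. \<sigma> (?\<Phi>1 (R q)) - \<kappa> * ?\<Phi>1 q) q 0 0" if q: "q \<in> D" for q
      using has_pd_diff[OF reflected_pd[OF gauge_pd(1)[OF R_D[OF q] R_D[OF q]]] has_pd_linear[OF lin gauge_pd(1)[OF q q]], of a a]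
        \<kappa>(2,3)[OF q] \<Phi>'[OF q] by simp
    from constant_if_pd_zero[OF D_open D_connected this p p0(1)]
    show ?thesis using p0(2) \<Phi>1_0 by simp
  qed
  have reflE: "\<sigma> (?E1 (R p)) = ?E1 p" if p: "p \<in> D" for p
  proof -
    have "has_pd (\<lambda>q. \<sigma> (?E1 (R q)) - ?E1 q) q 0 0" if q: "q \<in> D" for q
    proof -
      \<comment> \<open>The conjugated potential and the gradient of \<Phi> contribute conjugate
        phases, whose product is 1.\<close>
      have "cnj (?\<Phi>1 q) = cnj \<kappa> * \<kappa> * cnj (?\<Phi>1 q)" using cnj_\<kappa> by simp
      also have "\<dots> = \<kappa> * cnj (\<sigma> (?\<Phi>1 (R q)))" by (simp add: refl\<Phi>[OF q] mult_ac)
      finally have c: "\<kappa> * cnj (\<sigma> (?\<Phi>1 (R q))) = cnj (?\<Phi>1 q)" ..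
      have z: "\<sigma> (pd_z \<Phi> (R q)) = - (\<kappa> * pd_z \<Phi> q)" "\<sigma> (pd_rho \<Phi> (R q)) = \<kappa> * pd_rho \<Phi> q"
        using \<kappa>(2,3)[OF q] \<Phi>'[OF q] by (simp_all add: minus_equation_iff)
      have "- \<sigma> (ernst_G_z E \<Phi> (R q) - 2 * cnj (?\<Phi>1 (R q)) * pd_z \<Phi> (R q))
          = ernst_G_z E \<Phi> q - 2 * (\<kappa> * cnj (\<sigma> (?\<Phi>1 (R q)))) * pd_z \<Phi> q"
        by (simp add: G[OF q] z sigma_cnj mult_ac)
      moreover have "\<sigma> (ernst_G_rho E \<Phi> (R q) - 2 * cnj (?\<Phi>1 (R q)) * pd_rho \<Phi> (R q))
          = ernst_G_rho E \<Phi> q - 2 * (\<kappa> * cnj (\<sigma> (?\<Phi>1 (R q)))) * pd_rho \<Phi> q"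
        by (simp add: G[OF q] z sigma_cnj mult_ac)
      ultimately show ?thesis
        using has_pd_diff[OF reflected_pd[OF gauge_pd(2)[OF R_D[OF q] R_D[OF q]]] gauge_pd(2)[OF q q], of a b a b]
        unfolding c by simp
    qed
    from constant_if_pd_zero[OF D_open D_connected this p p0(1)]
    show ?thesis using p0(2) E1_0 by simp
  qed
  have "reflects D \<sigma> \<kappa> z0 ?E1 ?\<Phi>1"
    unfolding reflects_def using R_D reflE refl\<Phi> by blast
  then show ?thesis using \<kappa>(1) by blast
qed

text \<open>Differentiating the laws of the shifted potentials gives the behaviour of G and of the
  gradient of \<Phi>, hence of the gradients of \<omega> and \<gamma>. \<open>f\<close> is gauge
  invariant and is compared directly.\<close>

lemma reflects_potentials_imp_metric:
  assumes \<kappa>: "cmod \<kappa> = 1" and refl: "reflects D \<sigma> \<kappa> z0 (gauge_E a b E \<Phi>) (gauge_Phi a \<Phi>)"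
  shows "\<exists>k. reflects_metric k"
proof (cases "D = {}")
  case True
  then show ?thesis unfolding reflects_metric_def by blast
next
  case False
  let ?E1 = "gauge_E a b E \<Phi>" and ?\<Phi>1 = "gauge_Phi a \<Phi>"
  have R_D: "R p \<in> D" and reflE: "\<sigma> (?E1 (R p)) = ?E1 p" and refl\<Phi>: "\<sigma> (?\<Phi>1 (R p)) = \<kappa> * ?\<Phi>1 p" if "p \<in> D" for p
    using refl that by (auto simp: reflects_def)
  have cnj_\<kappa>: "cnj \<kappa> * \<kappa> = 1" using complex_norm_square[of \<kappa>] \<kappa> by (simp add: mult.commute)
  note gauge_pd = gauge_invariance[OF potential_pd]
  have even_f: "f (R p) = f p" if p: "p \<in> D" for p
  proof -
    have "Re (?E1 (R p)) = Re (?E1 p)" using arg_cong[OF reflE[OF p], of Re] by simp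
    moreover have "cmod (?\<Phi>1 (R p)) = cmod (?\<Phi>1 p)"
      using arg_cong[OF refl\<Phi>[OF p], of cmod] \<kappa> by (simp add: norm_mult)
    ultimately have "ernst_f ?E1 ?\<Phi>1 (R p) = ernst_f ?E1 ?\<Phi>1 p" by (simp add: ernst_f_def)
    then show ?thesis
      using metric_pd(1)[OF p p] metric_pd(1)[OF R_D[OF p] R_D[OF p]] by (simp add: ernst_f_gauge)
  qed
  have d\<Phi>: "\<sigma> (pd_z \<Phi> (R p)) = - (\<kappa> * pd_z \<Phi> p)" "\<sigma> (pd_rho \<Phi> (R p)) = \<kappa> * pd_rho \<Phi> p" if p: "p \<in> D" for p
  proof -
    have lin: "bounded_linear (\<lambda>x. \<kappa> * x)" by (rule bounded_linear_mult_right)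
    have "has_pd (\<lambda>q. \<kappa> * ?\<Phi>1 q) p (- \<sigma> (pd_z \<Phi> (R p))) (\<sigma> (pd_rho \<Phi> (R p)))"
      by (rule has_pd_cong[OF reflected_pd[OF gauge_pd(1)[OF R_D[OF p] R_D[OF p]]] D_open p refl\<Phi>])
    from has_pd_imp(1,2)[OF this, unfolded has_pd_imp(1,2)[OF has_pd_linear[OF lin gauge_pd(1)[OF p p]]]]
    show "\<sigma> (pd_z \<Phi> (R p)) = - (\<kappa> * pd_z \<Phi> p)" "\<sigma> (pd_rho \<Phi> (R p)) = \<kappa> * pd_rho \<Phi> p" by simp_all
  qed
  have G: "\<sigma> (ernst_G_z E \<Phi> (R p)) = - ernst_G_z E \<Phi> p" "\<sigma> (ernst_G_rho E \<Phi> (R p)) = ernst_G_rho E \<Phi> p" if p: "p \<in> D" for p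
  proof -
    have "has_pd ?E1 p (- \<sigma> (ernst_G_z E \<Phi> (R p) - 2 * cnj (?\<Phi>1 (R p)) * pd_z \<Phi> (R p)))
        (\<sigma> (ernst_G_rho E \<Phi> (R p) - 2 * cnj (?\<Phi>1 (R p)) * pd_rho \<Phi> (R p)))"
      by (rule has_pd_cong[OF reflected_pd[OF gauge_pd(2)[OF R_D[OF p] R_D[OF p]]] D_open p reflE])
    note 1 = has_pd_imp(1,2)[OF this, unfolded has_pd_imp(1,2)[OF gauge_pd(2)[OF p p]]]
    have c: "cnj (\<kappa> * ?\<Phi>1 p) * (\<kappa> * x) = cnj (?\<Phi>1 p) * x" for x
    proof -
      have "cnj (\<kappa> * ?\<Phi>1 p) * (\<kappa> * x) = (cnj \<kappa> * \<kappa>) * (cnj (?\<Phi>1 p) * x)" by (simp add: mult_ac)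
      then show ?thesis by (simp only: cnj_\<kappa> mult_1)
    qed
    have 2: "\<sigma> (2 * cnj (?\<Phi>1 (R p)) * x) = 2 * (cnj (\<kappa> * ?\<Phi>1 p) * \<sigma> x)" for x
      by (simp only: sigma_simps sigma_cnj refl\<Phi>[OF p] mult.assoc)
    show "\<sigma> (ernst_G_z E \<Phi> (R p)) = - ernst_G_z E \<Phi> p" "\<sigma> (ernst_G_rho E \<Phi> (R p)) = ernst_G_rho E \<Phi> p"
      using 1 unfolding sigma_simps(2) 2 d\<Phi>[OF p] mult_minus_right c
      by (simp_all add: mult.assoc minus_equation_iff algebra_simps)
  qed
  obtain p0 where p0: "p0 \<in> D" "R p0 = p0"
    using connected_reflect_fixed_point[OF D_connected False R_D] by blast
  \<comment> \<open>The constant is read off at the mirror point: it is 0 for \<open>s = 1\<close>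
    and \<open>2 * \<omega> p0\<close> for \<open>s = -1\<close>.\<close>
  have even_\<omega>: "\<omega> (R p) = s * \<omega> p + (\<omega> p0 - s * \<omega> p0)" if p: "p \<in> D" for p
  proof -
    have lin: "bounded_linear (\<lambda>x. s * x)" by (rule bounded_linear_mult_right)
    have "has_pd (\<lambda>q. \<omega> (R q) - s * \<omega> q) q 0 0" if q: "q \<in> D" for q
    proof -
      have "Im (ernst_G_z E \<Phi> q) = s * Im (ernst_G_z E \<Phi> (R q))"
        "Im (ernst_G_rho E \<Phi> q) = - s * Im (ernst_G_rho E \<Phi> (R q))"
        using arg_cong[OF G(1)[OF q], of Im] arg_cong[OF G(2)[OF q], of Im] by simp_all
      then show ?thesis
        using has_pd_diff[OF has_pd_reflect[OF metric_pd(2)[OF R_D[OF q] R_D[OF q]]] has_pd_linear[OF lin metric_pd(2)[OF q q]]]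
        by (simp add: even_f[OF q] mult.left_commute)
    qed
    from constant_if_pd_zero[OF D_open D_connected this p p0(1)]
    show ?thesis using p0(2) by simp
  qed
  have even_\<gamma>: "\<gamma> (R p) = \<gamma> p" if p: "p \<in> D" for p
  proof -
    have "has_pd (\<lambda>q. \<gamma> (R q) - \<gamma> q) q 0 0" if q: "q \<in> D" for q
    proof -
      have Re_G: "Re (ernst_G_rho E \<Phi> (R q) * cnj (ernst_G_z E \<Phi> (R q))) = - Re (ernst_G_rho E \<Phi> q * cnj (ernst_G_z E \<Phi> q))"
      proof -
        have "Re (ernst_G_rho E \<Phi> (R q) * cnj (ernst_G_z E \<Phi> (R q)))
            = Re (\<sigma> (ernst_G_rho E \<Phi> (R q)) * cnj (\<sigma> (ernst_G_z E \<Phi> (R q))))"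
          by (simp only: sigma_cnj[symmetric] sigma_simps(3)[symmetric] sigma_simps(11))
        then show ?thesis by (simp add: G[OF q])
      qed
      have Re_\<Phi>: "Re (pd_rho \<Phi> (R q) * cnj (pd_z \<Phi> (R q))) = - Re (pd_rho \<Phi> q * cnj (pd_z \<Phi> q))"
      proof -
        have "Re (pd_rho \<Phi> (R q) * cnj (pd_z \<Phi> (R q)))
            = Re (\<sigma> (pd_rho \<Phi> (R q)) * cnj (\<sigma> (pd_z \<Phi> (R q))))"
          by (simp only: sigma_cnj[symmetric] sigma_simps(3)[symmetric] sigma_simps(11))
        also have "\<dots> = Re (- ((cnj \<kappa> * \<kappa>) * (pd_rho \<Phi> q * cnj (pd_z \<Phi> q))))"
          by (simp only: d\<Phi>[OF q] complex_cnj_minus complex_cnj_mult mult_minus_right mult_ac)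
        finally show ?thesis by (simp only: cnj_\<kappa> mult_1 uminus_complex.sel)
      qed
      have norm_\<Phi>: "cmod (pd_rho \<Phi> (R q)) = cmod (pd_rho \<Phi> q)" "cmod (pd_z \<Phi> (R q)) = cmod (pd_z \<Phi> q)"
        using arg_cong[OF d\<Phi>(1)[OF q], of cmod] arg_cong[OF d\<Phi>(2)[OF q], of cmod] \<kappa> by (simp_all add: norm_mult)
      have norm_G: "cmod (ernst_G_rho E \<Phi> (R q)) = cmod (ernst_G_rho E \<Phi> q)" "cmod (ernst_G_z E \<Phi> (R q)) = cmod (ernst_G_z E \<Phi> q)"
        using arg_cong[OF G(1)[OF q], of cmod] arg_cong[OF G(2)[OF q], of cmod] by simp_all
      note h = has_pd_diff[OF has_pd_reflect[OF metric_pd(3)[OF R_D[OF q] R_D[OF q], unfolded Re_G Re_\<Phi> norm_\<Phi> norm_G even_f[OF q] snd_reflect]]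
          metric_pd(3)[OF q q]]
      have "- (c * (2 * - x) - d * (2 * - y)) - (c * (2 * x) - d * (2 * y)) = 0" for c d x y :: real
        by simp
      from h[unfolded this diff_self] show ?thesis .
    qed
    from constant_if_pd_zero[OF D_open D_connected this p p0(1)]
    show ?thesis using p0(2) by simp
  qed
  show ?thesis
    unfolding reflects_metric_def using R_D even_f even_\<gamma> even_\<omega> by blast
qed

text \<open>In the limit at infinity the reflection law of the shifted potential becomes \<open>\<sigma> a = \<kappa> a\<close>, so the shift drops out.\<close>

lemma reflects_normalized:
  assumes norm: "normalized_at_infinity D E \<Phi>" and \<kappa>: "cmod \<kappa> = 1"
    and refl: "reflects D \<sigma> \<kappa> z0 (gauge_E a b E \<Phi>) (gauge_Phi a \<Phi>)"
  shows "reflects D \<sigma> \<kappa> z0 E \<Phi>"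
proof -
  define F where "F = inf at_infinity (principal D)"
  have lim: "((\<lambda>p. Im (E p)) \<longlongrightarrow> 0) F" "(\<Phi> \<longlongrightarrow> 0) F" and unb: "\<not> bounded D"
    using norm by (auto simp: normalized_at_infinity_def F_def)
  have R_D: "R p \<in> D" and reflE: "\<sigma> (gauge_E a b E \<Phi> (R p)) = gauge_E a b E \<Phi> p"
    and refl\<Phi>: "\<sigma> (gauge_Phi a \<Phi> (R p)) = \<kappa> * gauge_Phi a \<Phi> p" if "p \<in> D" for p
    using refl that by (auto simp: reflects_def)
  \<comment> \<open>Limits along the filter are unique only if it is nontrivial, which is the
    unboundedness of the region.\<close>
  have nontriv: "F \<noteq> bot"
  proof
    assume "F = bot"
    then have "eventually (\<lambda>p. p \<notin> D) at_infinity"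
      unfolding F_def trivial_limit_def eventually_inf_principal by simp
    then obtain B where "\<And>p. norm p \<ge> B \<Longrightarrow> p \<notin> D" unfolding eventually_at_infinity by blast
    then have "\<forall>p\<in>D. norm p \<le> B" by (metis linear)
    then show False using unb unfolding bounded_iff by blast
  qed
  have ev: "eventually (\<lambda>p. p \<in> D) F" unfolding F_def eventually_inf_principal by simp
  have R_lim: "filterlim R F F" unfolding F_def by (rule reflect_at_infinity[OF R_D])
  have limR: "((\<lambda>p. Im (E (R p))) \<longlongrightarrow> 0) F" "((\<lambda>p. \<Phi> (R p)) \<longlongrightarrow> 0) F"
    using filterlim_compose[OF lim(1) R_lim] filterlim_compose[OF lim(2) R_lim] by auto
  have a: "\<sigma> a = \<kappa> * a"
  proof -
    have "((\<lambda>p. \<sigma> (\<Phi> (R p) + a) - \<kappa> * (\<Phi> p + a)) \<longlongrightarrow> \<sigma> (0 + a) - \<kappa> * (0 + a)) F"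
      by (intro tendsto_intros bounded_linear.tendsto[OF sigma_linear] limR lim)
    moreover have "((\<lambda>p. \<sigma> (\<Phi> (R p) + a) - \<kappa> * (\<Phi> p + a)) \<longlongrightarrow> 0) F"
      by (rule tendsto_eventually, rule eventually_mono[OF ev]) (use refl\<Phi> in \<open>simp add: gauge_Phi_def del: sigma_simps(1)\<close>)
    ultimately have "\<sigma> (0 + a) - \<kappa> * (0 + a) = 0" using tendsto_unique[OF nontriv] by blast
    then show ?thesis by simp
  qed
  have \<Phi>_refl: "\<sigma> (\<Phi> (R p)) = \<kappa> * \<Phi> p" if "p \<in> D" for p
    using refl\<Phi>[OF that] a by (simp add: gauge_Phi_def distrib_left)
  have cnj_\<kappa>: "cnj \<kappa> * \<kappa> = 1" using complex_norm_square[of \<kappa>] \<kappa> by (simp add: mult.commute)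
  have E_refl: "\<sigma> (E (R p)) + \<sigma> (\<i> * of_real b) = E p + \<i> * of_real b" if "p \<in> D" for p
  proof -
    \<comment> \<open>By \<open>\<sigma> a = \<kappa> * a\<close> the phases cancel in this product,
      so the gauge term has the same value on both sides of the law.\<close>
    have "\<sigma> (cnj a) * \<sigma> (\<Phi> (R p)) = cnj \<kappa> * \<kappa> * (cnj a * \<Phi> p)"
      by (simp add: sigma_cnj a \<Phi>_refl[OF that] mult_ac)
    then have 1: "\<sigma> (2 * cnj a * \<Phi> (R p)) = 2 * cnj a * \<Phi> p" by (simp add: cnj_\<kappa> mult.assoc)
    have "\<sigma> (E (R p)) - \<sigma> (2 * cnj a * \<Phi> (R p)) - of_real ((cmod a)\<^sup>2) + \<sigma> (\<i> * of_real b)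
        = E p - 2 * cnj a * \<Phi> p - of_real ((cmod a)\<^sup>2) + \<i> * of_real b"
      using reflE[OF that] unfolding gauge_E_def sigma_simps(1,2,6) .
    then show ?thesis unfolding 1 by (simp add: algebra_simps)
  qed
  \<comment> \<open>The limit gives \<open>- s * b = b\<close>, which forces \<open>b = 0\<close>
    when \<sigma> is conjugation and is an identity otherwise; either way \<sigma> fixes the
    shift.\<close>
  have "Im (\<sigma> (\<i> * of_real b)) = b"
  proof -
    have "((\<lambda>p. - s * Im (E (R p)) - Im (E p)) \<longlongrightarrow> - s * 0 - 0) F"
      by (intro tendsto_intros limR lim)
    moreover have "((\<lambda>p. - s * Im (E (R p)) - Im (E p)) \<longlongrightarrow> b - Im (\<sigma> (\<i> * of_real b))) F"
    proof (rule tendsto_eventually, rule eventually_mono[OF ev])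
      fix p assume "p \<in> D"
      from arg_cong[OF E_refl[OF this], of Im]
      show "- s * Im (E (R p)) - Im (E p) = b - Im (\<sigma> (\<i> * of_real b))" by simp
    qed
    ultimately have "- s * 0 - 0 = b - Im (\<sigma> (\<i> * of_real b))" using tendsto_unique[OF nontriv] by blast
    then show ?thesis by simp
  qed
  moreover have "Re (\<sigma> (\<i> * of_real b)) = 0" unfolding sigma_simps(11) by simp
  ultimately have "\<sigma> (\<i> * of_real b) = \<i> * of_real b" by (simp add: complex_eq_iff)
  then have "\<sigma> (E (R p)) = E p" if "p \<in> D" for p using E_refl[OF that] by (simp only: add_right_cancel)
  then show ?thesis unfolding reflects_def using R_D \<Phi>_refl by blast
qed

lemma reflects_metric_iff_gauge:
  "(\<exists>k. reflects_metric k) \<longleftrightarrow>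
    (\<exists>a b \<kappa>. cmod \<kappa> = 1 \<and> reflects D \<sigma> \<kappa> z0 (gauge_E a b E \<Phi>) (gauge_Phi a \<Phi>))"
  using reflects_metric_imp_potentials reflects_potentials_imp_metric by blast

lemma reflects_metric_iff_normalized:
  assumes "normalized_at_infinity D E \<Phi>"
  shows "(\<exists>k. reflects_metric k) \<longleftrightarrow> (\<exists>\<kappa>. cmod \<kappa> = 1 \<and> reflects D \<sigma> \<kappa> z0 E \<Phi>)"
proof -
  have "gauge_E 0 0 E \<Phi> = E" "gauge_Phi 0 \<Phi> = \<Phi>" by (simp_all add: fun_eq_iff gauge_E_def gauge_Phi_def)
  then show ?thesis
    unfolding reflects_metric_iff_gauge using reflects_normalized[OF assms] by metis
qed

end

theorem theorem1:
  fixes D :: "(real \<times> real) set"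
    and E \<Phi> :: "real \<times> real \<Rightarrow> complex"
    and f \<omega> \<gamma> :: "real \<times> real \<Rightarrow> real"
  assumes "open D" and "connected D" and "\<forall>p\<in>D. snd p > 0"
    and "ernst_solution D E \<Phi>"
    and "metric_fields D E \<Phi> f \<omega> \<gamma>"
  shows
    "(equatorially_symmetric D f \<omega> \<gamma> \<longleftrightarrow>
        (\<exists>a b. symmetric_potentials D (gauge_E a b E \<Phi>) (gauge_Phi a \<Phi>))) \<and>
     (equatorially_antisymmetric D f \<omega> \<gamma> \<longleftrightarrow>
        (\<exists>a b. antisymmetric_potentials D (gauge_E a b E \<Phi>) (gauge_Phi a \<Phi>))) \<and>
     (normalized_at_infinity D E \<Phi> \<longrightarrow>
        (equatorially_symmetric D f \<omega> \<gamma> \<longleftrightarrow> symmetric_potentials D E \<Phi>) \<and>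
        (equatorially_antisymmetric D f \<omega> \<gamma> \<longleftrightarrow> antisymmetric_potentials D E \<Phi>))"
proof -
  interpret sym: ernst_reflection D E \<Phi> f \<omega> \<gamma> cnj 1 z0 for z0
    using assms by unfold_locales auto
  interpret anti: ernst_reflection D E \<Phi> f \<omega> \<gamma> "\<lambda>x. x" "-1" z0 for z0
    using assms by unfold_locales auto
  have 1: "equatorially_symmetric D f \<omega> \<gamma> \<longleftrightarrow> (\<exists>z0 k. sym.reflects_metric z0 k)"
  proof
    assume "equatorially_symmetric D f \<omega> \<gamma>"
    then obtain z0 where "sym.reflects_metric z0 0"
      unfolding equatorially_symmetric_def sym.reflects_metric_def by auto
    then show "\<exists>z0 k. sym.reflects_metric z0 k" by blast
  next
    assume "\<exists>z0 k. sym.reflects_metric z0 k"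
    then obtain z0 k where *: "\<And>p. p \<in> D \<Longrightarrow> reflect z0 p \<in> D \<and> f (reflect z0 p) = f p \<and>
        \<gamma> (reflect z0 p) = \<gamma> p \<and> \<omega> (reflect z0 p) = \<omega> p + k"
      unfolding sym.reflects_metric_def by auto
    \<comment> \<open>At a point of the mirror line the law for \<omega> equates a value with itself
      plus \<open>k\<close>.\<close>
    have "k = 0" if "D \<noteq> {}"
      using connected_reflect_fixed_point[OF assms(2) that, of z0] * by (metis add_cancel_right_right)
    then have "\<forall>p\<in>D. reflect z0 p \<in> D \<and> f (reflect z0 p) = f p \<and> \<omega> (reflect z0 p) = \<omega> p \<and> \<gamma> (reflect z0 p) = \<gamma> p"
      using * by auto
    then show "equatorially_symmetric D f \<omega> \<gamma>" unfolding equatorially_symmetric_def by blast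
  qed
  have 2: "equatorially_antisymmetric D f \<omega> \<gamma> \<longleftrightarrow> (\<exists>z0 k. anti.reflects_metric z0 k)"
  proof
    assume "equatorially_antisymmetric D f \<omega> \<gamma>"
    then obtain z0 w where *: "\<forall>p\<in>D. reflect z0 p \<in> D \<and> f (reflect z0 p) = f p \<and> \<gamma> (reflect z0 p) = \<gamma> p \<and>
        \<omega> (reflect z0 p) - w = - (\<omega> p - w)"
      unfolding equatorially_antisymmetric_def by blast
    have "anti.reflects_metric z0 (2 * w)"
      unfolding anti.reflects_metric_def using * by (auto simp: algebra_simps)
    then show "\<exists>z0 k. anti.reflects_metric z0 k" by blast
  next
    assume "\<exists>z0 k. anti.reflects_metric z0 k"
    then obtain z0 k where *: "anti.reflects_metric z0 k" by blast
    have "\<forall>p\<in>D. reflect z0 p \<in> D \<and> f (reflect z0 p) = f p \<and> \<gamma> (reflect z0 p) = \<gamma> p \<and>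
        \<omega> (reflect z0 p) - k / 2 = - (\<omega> p - k / 2)"
      using * unfolding anti.reflects_metric_def by auto
    then show "equatorially_antisymmetric D f \<omega> \<gamma>" unfolding equatorially_antisymmetric_def by blast
  qed
  have 3: "equatorially_symmetric D f \<omega> \<gamma> \<longleftrightarrow> (\<exists>a b. symmetric_potentials D (gauge_E a b E \<Phi>) (gauge_Phi a \<Phi>))"
    unfolding 1 sym.reflects_metric_iff_gauge symmetric_potentials_iff by blast
  have 4: "equatorially_antisymmetric D f \<omega> \<gamma> \<longleftrightarrow> (\<exists>a b. antisymmetric_potentials D (gauge_E a b E \<Phi>) (gauge_Phi a \<Phi>))"
    unfolding 2 anti.reflects_metric_iff_gauge antisymmetric_potentials_iff by blast
  have "equatorially_symmetric D f \<omega> \<gamma> \<longleftrightarrow> symmetric_potentials D E \<Phi>"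
    "equatorially_antisymmetric D f \<omega> \<gamma> \<longleftrightarrow> antisymmetric_potentials D E \<Phi>"
    if n: "normalized_at_infinity D E \<Phi>"
    unfolding 1 2 sym.reflects_metric_iff_normalized[OF n] anti.reflects_metric_iff_normalized[OF n]
      symmetric_potentials_iff antisymmetric_potentials_iff by blast+
  with 3 4 show ?thesis by blast
qed

end
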